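(* Assume that there is a known number $\delta>0$ such that the constant disturbance $\Delta\in\mathbb R^3$ satisfies $|\Delta|\le\delta$. Let $k_1,k_q,k_\Omega,\alpha>0$ and let $c,\epsilon,k_\Delta$ be constants such that $0<c<2$, $0\le\epsilon<\min\{2-\sqrt{2c},1\}$ and $k_\Delta>\delta^2/(2c)$. Apply the feedback $$\tau=-(\mathbb I\Omega)\times\Omega+\mathbb I\left(-k_1e_{q,v}-k_\Omega(e_\Omega-\eta)+\dot\eta+\dot\Omega_0\right)-\bar\Delta,$$ where $\bar\Delta(t)\in\mathbb R^3$ is generated by $$\dot{\bar\Delta}=\frac{k_\Delta}{2k_1}\mathbb I^{-1}(e_\Omega-\eta),\qquad \bar\Delta(0)=0,$$ to the error dynamics $$\dot e_q=\tfrac12(e_q\Omega_0-\Omega_0e_q)+\tfrac12(1+e_q)e_\Omega-\alpha(|q|^2-1)(1+e_q),$$ $$\dot e_\Omega=\mathbb I^{-1}((\mathbb I\Omega)\times\Omega)+\mathbb I^{-1}\tau+\mathbb I^{-1}\Delta-\dot\Omega_0 .$$ Then the tracking error trajectory $(e_q(t),e_\Omega(t))$ asymptotically converges to zero as $t\to\infty$, for any initial state $q(0)\in\mathbb H$ and any initial tracking error $(e_q(0),e_\Omega(0))$ that satisfy $$\left||q(0)|^2-1\right|\le\epsilon\qquad\text{and}\qquad V_{k_1}(e_q(0),e_\Omega(0))\le c-\frac{\delta^2}{2k_\Delta},$$ where $V_{k_1}(e_q,e_\Omega)=\frac12|e_q|^2+\frac1{4k_1}|e_\Omega-\eta|^2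$.
   Context: $\mathbb H$ is the set of quaternions with its usual product, conjugation $q\mapsto q^*$ and Euclidean norm $|q|$; ${\rm S}^3=\{q\in\mathbb H: |q|=1\}$. Pure quaternions (zero scalar part) are identified with vectors in $\mathbb R^3$, so products such as $q\Omega$ with $\Omega\in\mathbb R^3$ are quaternion products; $\times$ is the cross product on $\mathbb R^3$. For $e_q\in\mathbb H$, write $e_q=e_{q,s}+e_{q,v}$ with scalar part $e_{q,s}\in\mathbb R$ and vector part $e_{q,v}\in\mathbb R^3$. $\mathbb I\in\mathbb R^{3\times3}$ is the moment-of-inertia matrix of a rigid body (symmetric positive definite). The system is the extension to $\mathbb H\times\mathbb R^3$ of the rigid body dynamics with unknown constant disturbance $\Delta$: $$\dot q=\tfrac12q\Omega-\alpha(|q|^2-1)q,\qquad \dot\Omega=\mathbb I^{-1}((\mathbb I\Omega)\times\Omega)+\mathbb I^{-1}\tau+\mathbb I^{-1}\Delta,$$ with state $(q,\Omega)\in\mathbb H\times\mathbb R^3$, control $\tau\in\mathbb R^3$ and $\alpha>0$. The reference trajectory $(q_0(t),\Omega_0(t))\in{\rm S}^3\times\mathbb R^3$, $t\ge0$, satisfies $\dot q_0=\frac12q_0\Omega_0$, with $\Omega_0$ continuously differentiable. The tracking errors are $e_q=q_0^*q-1$ and $e_\Omega=\Omega-\Omega_0$; they satisfy the error dynamics displayed in the claim. Define $$\eta=-k_qe_{q,v}+2\alpha(e_{q,s}+|q|^2-1)e_{q,v},$$ $$\dot\eta=-k_q\dot e_{q,v}+2\alpha(e_{q,s}+|q|^2-1)\dot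 e_{q,v}+2\alpha\left(\dot e_{q,s}-2\alpha(|q|^2-1)|q|^2\right)e_{q,v},$$ where $\dot e_{q,s}$ and $\dot e_{q,v}$ denote the scalar and vector parts of $\tfrac12(e_q\Omega_0-\Omega_0e_q)+\tfrac12(1+e_q)e_\Omega-\alpha(|q|^2-1)(1+e_q)$. *)

theory Defs
  imports "HOL-Analysis.Analysis"
begin

text \<open>A quaternion is the pair of its scalar and vector part, with the vector-space structure and
  topology of the product type; the product norm is the Euclidean norm on the four coordinates.
  The product type carries no multiplication, so the quaternion product is defined here.\<close>

type_synonym quat = "real \<times> (real^3)"

abbreviation qscal :: "quat \<Rightarrow> real" where "qscal \<equiv> fst"
abbreviation qvec :: "quat \<Rightarrow> real^3" where "qvec \<equiv> snd"

definition qone :: quat where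
  "qone = (1, 0)"

definition qpure :: "real^3 \<Rightarrow> quat" where
  "qpure v = (0, v)"

definition qcnj :: "quat \<Rightarrow> quat" where
  "qcnj a = (qscal a, - qvec a)"

definition qmul :: "quat \<Rightarrow> quat \<Rightarrow> quat"  (infixl "\<otimes>" 70) where
  "a \<otimes> b = (qscal a * qscal b - qvec a \<bullet> qvec b,
            qscal a *\<^sub>R qvec b + qscal b *\<^sub>R qvec a + cross3 (qvec a) (qvec b))"

definition inertia_matrix :: "real^3^3 \<Rightarrow> bool" where
  "inertia_matrix J \<longleftrightarrow> transpose J = J \<and> (\<forall>x. x \<noteq> 0 \<longrightarrow> x \<bullet> (J *v x) > 0)"

text \<open>Time is \<open>{0..}\<close>; derivatives at \<open>0\<close> are one-sided. \<open>W0'\<close> is the derivative of \<open>W0\<close>.\<close>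

definition reference_trajectory ::
    "(real \<Rightarrow> quat) \<Rightarrow> (real \<Rightarrow> real^3) \<Rightarrow> (real \<Rightarrow> real^3) \<Rightarrow> bool" where
  "reference_trajectory q0 W0 W0' \<longleftrightarrow>
     (\<forall>t\<ge>0. norm (q0 t) = 1) \<and>
     (\<forall>t\<ge>0. (q0 has_vector_derivative (1/2) *\<^sub>R (q0 t \<otimes> qpure (W0 t))) (at t within {0..})) \<and>
     (\<forall>t\<ge>0. (W0 has_vector_derivative W0' t) (at t within {0..})) \<and>
     continuous_on {0..} W0'"

definition err_q :: "quat \<Rightarrow> quat \<Rightarrow> quat" where
  "err_q q0 q = qcnj q0 \<otimes> q - qone"

definition err_W :: "real^3 \<Rightarrow> real^3 \<Rightarrow> real^3" where
  "err_W W0 W = W - W0"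

definition err_q_rhs :: "real \<Rightarrow> real^3 \<Rightarrow> quat \<Rightarrow> quat \<Rightarrow> real^3 \<Rightarrow> quat" where
  "err_q_rhs \<alpha> W0 q eq eW =
     (1/2) *\<^sub>R (eq \<otimes> qpure W0 - qpure W0 \<otimes> eq)
     + (1/2) *\<^sub>R ((qone + eq) \<otimes> qpure eW)
     - (\<alpha> * ((norm q)\<^sup>2 - 1)) *\<^sub>R (qone + eq)"

definition err_W_rhs ::
    "real^3^3 \<Rightarrow> real^3 \<Rightarrow> real^3 \<Rightarrow> real^3 \<Rightarrow> real^3 \<Rightarrow> real^3" where
  "err_W_rhs J D W0' W \<tau> =
     matrix_inv J *v cross3 (J *v W) W + matrix_inv J *v \<tau> + matrix_inv J *v D - W0'"

definition eta :: "real \<Rightarrow> real \<Rightarrow> quat \<Rightarrow> quat \<Rightarrow> real^3" where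
  "eta kq \<alpha> q eq =
     - (kq *\<^sub>R qvec eq) + (2 * \<alpha> * (qscal eq + (norm q)\<^sup>2 - 1)) *\<^sub>R qvec eq"

definition eta_dot :: "real \<Rightarrow> real \<Rightarrow> real^3 \<Rightarrow> quat \<Rightarrow> quat \<Rightarrow> real^3 \<Rightarrow> real^3" where
  "eta_dot kq \<alpha> W0 q eq eW =
     (let deq = err_q_rhs \<alpha> W0 q eq eW in
        - (kq *\<^sub>R qvec deq)
        + (2 * \<alpha> * (qscal eq + (norm q)\<^sup>2 - 1)) *\<^sub>R qvec deq
        + (2 * \<alpha> * (qscal deq - 2 * \<alpha> * ((norm q)\<^sup>2 - 1) * (norm q)\<^sup>2)) *\<^sub>R qvec eq)"

text \<open>\<open>V\<close> takes the state \<open>q\<close> as well, because \<open>eta\<close> contains \<open>norm q\<close>.\<close>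

definition V :: "real \<Rightarrow> real \<Rightarrow> real \<Rightarrow> quat \<Rightarrow> quat \<Rightarrow> real^3 \<Rightarrow> real" where
  "V k1 kq \<alpha> q eq eW =
     1/2 * (norm eq)\<^sup>2 + 1 / (4 * k1) * (norm (eW - eta kq \<alpha> q eq))\<^sup>2"

definition feedback ::
    "real^3^3 \<Rightarrow> real \<Rightarrow> real \<Rightarrow> real \<Rightarrow> real \<Rightarrow> real^3 \<Rightarrow> real^3 \<Rightarrow>
     quat \<Rightarrow> real^3 \<Rightarrow> quat \<Rightarrow> real^3 \<Rightarrow> real^3 \<Rightarrow> real^3" where
  "feedback J k1 kq kW \<alpha> W0 W0' q W eq eW Db =
     - cross3 (J *v W) W
     + J *v (- (k1 *\<^sub>R qvec eq) - kW *\<^sub>R (eW - eta kq \<alpha> q eq)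
             + eta_dot kq \<alpha> W0 q eq eW + W0')
     - Db"

text \<open>\<open>(q, W)\<close> is the state, \<open>Db\<close> the disturbance estimate and \<open>D\<close> the actual disturbance.\<close>

definition closed_loop_solution ::
    "real^3^3 \<Rightarrow> real \<Rightarrow> real \<Rightarrow> real \<Rightarrow> real \<Rightarrow> real \<Rightarrow> real^3 \<Rightarrow>
     (real \<Rightarrow> quat) \<Rightarrow> (real \<Rightarrow> real^3) \<Rightarrow> (real \<Rightarrow> real^3) \<Rightarrow>
     (real \<Rightarrow> quat) \<Rightarrow> (real \<Rightarrow> real^3) \<Rightarrow> (real \<Rightarrow> real^3) \<Rightarrow> bool" where
  "closed_loop_solution J k1 kq kW kD \<alpha> D q0 W0 W0' q W Db \<longleftrightarrow>
     (let eq = (\<lambda>t. err_q (q0 t) (q t));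
          eW = (\<lambda>t. err_W (W0 t) (W t));
          \<tau> = (\<lambda>t. feedback J k1 kq kW \<alpha> (W0 t) (W0' t) (q t) (W t) (eq t) (eW t) (Db t))
      in
       (\<forall>t\<ge>0. (eq has_vector_derivative err_q_rhs \<alpha> (W0 t) (q t) (eq t) (eW t))
                 (at t within {0..})) \<and>
       (\<forall>t\<ge>0. (eW has_vector_derivative err_W_rhs J D (W0' t) (W t) (\<tau> t))
                 (at t within {0..})) \<and>
       (\<forall>t\<ge>0. (Db has_vector_derivative
                   (kD / (2 * k1)) *\<^sub>R (matrix_inv J *v (eW t - eta kq \<alpha> (q t) (eq t))))
                 (at t within {0..})) \<and>
       Db 0 = 0)"

end

theory Submission
  imports Defs
begin

text \<open>Put \<open>z = e\<^sub>\<Omega> - \<eta>\<close> and \<open>y = \<Delta> - \<Delta>'\<close> with \<open>\<Delta>'\<close> the disturbance estimate. Then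
  \<open>L = norm e\<^sup>2 / 2 + norm z\<^sup>2 / (4 * k1) + norm y\<^sup>2 / (2 * kD)\<close> has the derivative
  \<open>- kq / 2 * norm v\<^sup>2 - \<alpha> * s\<^sup>2 * (1 + s + norm q\<^sup>2) - kW / (2 * k1) * norm z\<^sup>2\<close> for \<open>e = (s, v)\<close>.
  On \<open>L \<le> c\<close> we have \<open>s \<ge> - sqrt (2 * c)\<close>, and \<open>norm q\<^sup>2 \<ge> 1 - \<epsilon>\<close> persists because
  \<open>norm q\<^sup>2 - 1\<close> decays in absolute value; so the middle factor stays above
  \<open>2 - sqrt (2 * c) - \<epsilon> > 0\<close> and the sublevel set is invariant. Invariance excludes blow-up,
  which gives global existence, and a Barbalat argument gives \<open>e, z \<longrightarrow> 0\<close>, hence \<open>e\<^sub>\<Omega> \<longrightarrow> 0\<close>.\<close>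

section \<open>Differential equations on the half-line\<close>

text \<open>The mean value theorem asks for derivatives only between the endpoints, where the filter
  within \<open>{0..}\<close> is the two-sided one; at the endpoints, possibly \<open>0\<close>,
  continuity is enough.\<close>

lemma nonincreasing_on_halfline:
  fixes f :: "real \<Rightarrow> real"
  assumes "0 \<le> a" "a \<le> b"
    and d: "\<And>t. \<lbrakk>a \<le> t; t \<le> b\<rbrakk> \<Longrightarrow> (f has_vector_derivative f' t) (at t within {0..})"
    and n: "\<And>t. \<lbrakk>a \<le> t; t \<le> b\<rbrakk> \<Longrightarrow> f' t \<le> 0"
  shows "f b \<le> f a"
proof (rule DERIV_nonpos_imp_decreasing_open[OF \<open>a \<le> b\<close>])
  fix t assume t: "a < t" "t < b"
  then have t0: "a \<le> t" "t \<le> b" "0 < t" using \<open>0 \<le> a\<close> by auto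
  then have "t \<in> interior {0..}" by (simp add: interior_real_atLeast)
  then have "at t within {0..} = at t" by (rule at_within_interior)
  with d[OF t0(1,2)] have "DERIV f t :> f' t"
    by (simp only: has_real_derivative_iff_has_vector_derivative)
  with n[OF t0(1,2)] show "\<exists>y. DERIV f t :> y \<and> y \<le> 0" by blast
next
  show "continuous_on {a..b} f"
    unfolding continuous_on_eq_continuous_within
  proof
    fix t assume t: "t \<in> {a..b}"
    then have "continuous (at t within {0..}) f"
      by (intro has_vector_derivative_continuous[OF d]) simp_all
    moreover have "{a..b} \<subseteq> {0..}" using \<open>0 \<le> a\<close> by auto
    ultimately show "continuous (at t within {a..b}) f"
      by (rule continuous_within_subset)
  qed
qed

text \<open>Continuous induction, for estimates valid only while the path is in \<open>U\<close>. At
  the supremum \<open>T\<close> of the times up to which the path stays in \<open>K\<close>,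
  closedness gives \<open>x T \<in> K\<close>; openness of \<open>U\<close> then provides a further
  interval on which \<open>step\<close> applies.\<close>

lemma invariant_barrier:
  fixes x :: "real \<Rightarrow> 'a::t2_space"
  assumes cont: "continuous_on {0..} x"
    and K: "closed K" and U: "open U" and KU: "K \<subseteq> U" and x0: "x 0 \<in> K"
    and step: "\<And>a b. \<lbrakk>0 \<le> a; a \<le> b; x a \<in> K; \<And>t. \<lbrakk>a \<le> t; t \<le> b\<rbrakk> \<Longrightarrow> x t \<in> U\<rbrakk> \<Longrightarrow> x b \<in> K"
    and "0 \<le> t"
  shows "x t \<in> K"
proof -
  define S where "S = {0..t} \<inter> {s. \<forall>r\<in>{0..s}. x r \<in> K}"
  have S0: "0 \<in> S" using x0 \<open>0 \<le> t\<close> by (auto simp: S_def)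
  have Sb: "bdd_above S" by (auto simp: S_def intro: bdd_aboveI[of _ t])
  define T where "T = Sup S"
  have T0: "0 \<le> T" unfolding T_def by (rule cSup_upper[OF S0 Sb])
  have Tt: "T \<le> t" unfolding T_def by (rule cSup_least) (use S0 in \<open>auto simp: S_def\<close>)
  have below: "x r \<in> K" if "0 \<le> r" "r < T" for r
  proof -
    obtain s where "s \<in> S" "r < s"
      using \<open>r < T\<close> less_cSup_iff[OF _ Sb] S0 unfolding T_def by blast
    then show ?thesis using \<open>0 \<le> r\<close> by (auto simp: S_def)
  qed
  have xT: "x T \<in> K"
  proof (cases "T = 0")
    case False
    with T0 have "0 < T" by simp
    have "(x \<longlongrightarrow> x T) (at T within {0..})"
      using cont T0 by (auto simp: continuous_on_def)
    then have lim: "(x \<longlongrightarrow> x T) (at T within {0..<T})"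
      by (rule tendsto_within_subset) auto
    have nt: "at T within {0..<T} \<noteq> bot"
      using \<open>0 < T\<close> by (simp add: trivial_limit_within islimpt_Ico)
    show ?thesis
      by (rule Lim_in_closed_set[OF K _ nt lim])
        (use below in \<open>auto simp: eventually_at_filter\<close>)
  qed (use x0 in simp)
  have all: "x r \<in> K" if "0 \<le> r" "r \<le> T" for r
    using below[of r] xT that by (cases "r = T") auto
  have "T = t"
  proof (rule ccontr)
    assume "T \<noteq> t"
    with Tt have "T < t" by simp
    have "(x \<longlongrightarrow> x T) (at T within {0..})"
      using cont T0 by (auto simp: continuous_on_def)
    then have "\<forall>\<^sub>F s in at T within {0..}. x s \<in> U"
      using xT KU U by (auto simp: tendsto_def)
    then obtain d where d: "d > 0" "\<And>s. \<lbrakk>0 \<le> s; s \<noteq> T; dist s T < d\<rbrakk> \<Longrightarrow> x s \<in> U"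
      by (auto simp: eventually_at)
    \<comment> \<open>Half of \<open>d\<close> keeps all of \<open>[T, b]\<close> within distance
      \<open>d\<close> of \<open>T\<close>; \<open>t\<close> caps \<open>b\<close> because
      \<open>S\<close> lies in \<open>{0..t}\<close>.\<close>
    define b where "b = min t (T + d/2)"
    have "x r \<in> U" if "T \<le> r" "r \<le> b" for r
      using d(2)[of r] that T0 \<open>d > 0\<close> xT KU by (cases "r = T") (auto simp: b_def dist_real_def)
    then have "x s \<in> K" if "T \<le> s" "s \<le> b" for s
      using step[OF T0 _ xT, of s] that by auto
    with all have "\<forall>r\<in>{0..b}. x r \<in> K" by (meson atLeastAtMost_iff linear)
    moreover have "0 \<le> b" "b \<le> t" "T < b" using T0 \<open>T < t\<close> \<open>d > 0\<close> by (auto simp: b_def)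
    ultimately have "b \<in> S" by (auto simp: S_def)
    then have "b \<le> T" unfolding T_def by (rule cSup_upper[OF _ Sb])
    with \<open>T < b\<close> show False by simp
  qed
  then show ?thesis using all[of t] \<open>0 \<le> t\<close> by simp
qed

text \<open>Barbalat's lemma without integrals: as \<open>g\<close> falls at most at rate \<open>M\<close>, the function \<open>w\<close> loses at
  least \<open>\<kappa> * h * (g t - M * h)\<close> on \<open>[t, t + h]\<close>; being antitone and bounded below, it loses ever less.\<close>

lemma lyapunov_rate_tendsto_0:
  fixes w g :: "real \<Rightarrow> real"
  assumes w: "\<And>t. 0 \<le> t \<Longrightarrow> (w has_vector_derivative w' t) (at t within {0..})"
    and g: "\<And>t. 0 \<le> t \<Longrightarrow> (g has_vector_derivative g' t) (at t within {0..})"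
    and w0: "\<And>t. 0 \<le> t \<Longrightarrow> 0 \<le> w t" and g0: "\<And>t. 0 \<le> t \<Longrightarrow> 0 \<le> g t"
    and w': "\<And>t. 0 \<le> t \<Longrightarrow> w' t \<le> - \<kappa> * g t" and "\<kappa> > 0"
    and g': "\<And>t. 0 \<le> t \<Longrightarrow> \<bar>g' t\<bar> \<le> M"
  shows "(g \<longlongrightarrow> 0) at_top"
proof -
  have gD: "(g has_real_derivative g' t) (at t within {0..})"
    and wD: "(w has_real_derivative w' t) (at t within {0..})" if "0 \<le> t" for t
    using g[OF that] w[OF that] by (simp_all add: has_real_derivative_iff_has_vector_derivative)
  \<comment> \<open>\<open>M\<close> may be \<open>0\<close>, while the window length
    \<open>h\<close> below divides by the bound.\<close>
  define M1 where "M1 = M + 1"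
  have "M \<ge> 0" using g'[of 0] by simp
  then have "M1 > 0" by (simp add: M1_def)
  have gl: "g t - M1 * h \<le> g (t + h)" if "0 \<le> t" "0 \<le> h" for t h
  proof -
    have "(\<lambda>s. - g s - M1 * (s - t)) (t + h) \<le> (\<lambda>s. - g s - M1 * (s - t)) t"
    proof (rule nonincreasing_on_halfline[where f = "\<lambda>s. - g s - M1 * (s - t)" and f' = "\<lambda>s. - g' s - M1"])
      fix s assume "t \<le> s"
      with \<open>0 \<le> t\<close> have "0 \<le> s" by simp
      note [derivative_intros] = gD[OF this]
      show "((\<lambda>s. - g s - M1 * (s - t)) has_vector_derivative - g' s - M1) (at s within {0..})"
        unfolding has_real_derivative_iff_has_vector_derivative[symmetric]
        by (auto intro!: derivative_eq_intros)
      show "- g' s - M1 \<le> 0" using g'[OF \<open>0 \<le> s\<close>] by (simp add: M1_def)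
    qed (use that in auto)
    then show ?thesis by simp
  qed
  have wl: "w (t + h) \<le> w t - \<kappa> * h * (g t - M1 * h)" if "0 \<le> t" "0 \<le> h" for t h
  proof -
    \<comment> \<open>By \<open>gl\<close>, \<open>?c\<close> bounds \<open>\<kappa> * g\<close>
      from below on all of \<open>[t, t + h]\<close>, so \<open>w\<close> plus the ramp
      \<open>?c * (s - t)\<close> is still nonincreasing there.\<close>
    let ?c = "\<kappa> * (g t - M1 * h)"
    have "(\<lambda>s. w s + ?c * (s - t)) (t + h) \<le> (\<lambda>s. w s + ?c * (s - t)) t"
    proof (rule nonincreasing_on_halfline[where f = "\<lambda>s. w s + ?c * (s - t)" and f' = "\<lambda>s. w' s + ?c"])
      fix s assume s: "t \<le> s" "s \<le> t + h"
      with \<open>0 \<le> t\<close> have "0 \<le> s" by simp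
      note [derivative_intros] = wD[OF this]
      show "((\<lambda>s. w s + ?c * (s - t)) has_vector_derivative w' s + ?c) (at s within {0..})"
        unfolding has_real_derivative_iff_has_vector_derivative[symmetric]
        by (auto intro!: derivative_eq_intros)
      have "g t - M1 * h \<le> g t - M1 * (s - t)"
        using s \<open>M1 > 0\<close> by (simp add: mult_left_mono)
      also have "\<dots> \<le> g s" using gl[OF \<open>0 \<le> t\<close>, of "s - t"] s by simp
      finally have "?c \<le> \<kappa> * g s" using \<open>\<kappa> > 0\<close> by simp
      then show "w' s + ?c \<le> 0" using w'[OF \<open>0 \<le> s\<close>] by simp
    qed (use that in auto)
    then show ?thesis by (simp add: algebra_simps)
  qed
  have w'0: "w' t \<le> 0" if "0 \<le> t" for t
    using w'[OF that] mult_nonneg_nonneg[OF less_imp_le[OF \<open>\<kappa> > 0\<close>] g0[OF that]] by linarith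
  have dec: "w b \<le> w a" if "0 \<le> a" "a \<le> b" for a b
    by (rule nonincreasing_on_halfline[where f = w and f' = w', OF that]) (use that w w'0 in auto)
  define I where "I = Inf (w ` {0..})"
  have bdd: "bdd_below (w ` {0..})" using w0 by (auto intro!: bdd_belowI[of _ 0])
  have Il: "I \<le> w t" if "0 \<le> t" for t
    unfolding I_def by (rule cInf_lower[OF _ bdd]) (use that in auto)
  have "\<forall>\<^sub>F t in at_top. \<bar>g t\<bar> < r" if "r > 0" for r
  proof -
    \<comment> \<open>This makes \<open>M1 * h = r / 2\<close>: if \<open>g t \<ge> r\<close>, then
      \<open>w\<close> loses at least \<open>\<kappa> * h * (r / 2)\<close> on
      \<open>[t, t + h]\<close>, impossible once \<open>w\<close> is closer than that to its
      infimum.\<close>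
    define h where "h = r / (2 * M1)"
    have "h > 0" using \<open>r > 0\<close> \<open>M1 > 0\<close> by (simp add: h_def)
    have "\<exists>a\<ge>0. w a < I + \<kappa> * h * (r / 2)"
    proof (rule ccontr)
      assume "\<not> ?thesis"
      then have "I + \<kappa> * h * (r / 2) \<le> w t" if "0 \<le> t" for t
        using that by (meson not_less)
      then have "I + \<kappa> * h * (r / 2) \<le> Inf (w ` {0..})"
        by (intro cInf_greatest) auto
      then have "I + \<kappa> * h * (r / 2) \<le> I" by (simp add: I_def)
      moreover have "\<kappa> * h * (r / 2) > 0" using \<open>\<kappa> > 0\<close> \<open>h > 0\<close> \<open>r > 0\<close> by simp
      ultimately show False by linarith
    qed
    then obtain a where a: "a \<ge> 0" "w a < I + \<kappa> * h * (r / 2)" by blast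
    have "\<bar>g t\<bar> < r" if "t \<ge> a" for t
    proof -
      have t: "0 \<le> t" using that a by simp
      have "I \<le> w t - \<kappa> * h * (g t - M1 * h)"
        using wl[OF t, of h] Il[of "t + h"] t \<open>h > 0\<close> by simp
      moreover have "w t < I + \<kappa> * h * (r / 2)" using dec[OF a(1) that] a(2) by simp
      ultimately have "\<kappa> * h * (g t - M1 * h) < \<kappa> * h * (r / 2)" by simp
      then have "g t - M1 * h < r / 2"
        using \<open>\<kappa> > 0\<close> \<open>h > 0\<close> mult_less_cancel_left_pos[of "\<kappa> * h"] by simp
      then show ?thesis using g0[OF t] \<open>M1 > 0\<close> by (simp add: h_def)
    qed
    then show ?thesis by (auto simp: eventually_at_top_linorder)
  qed
  then show ?thesis by (auto simp: tendsto_iff)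
qed

section \<open>Global existence for Lipschitz fields\<close>

lemma at_within_Icc_eq_at_within_Ici:
  fixes a t b :: real
  assumes "a \<le> t" "t < b"
  shows "at t within {a..b} = at t within {a..}"
  by (rule at_within_nhd[of t "{..<b}"]) (use assms in auto)

lemma integral_has_vector_derivative_halfline:
  fixes g :: "real \<Rightarrow> 'a::banach"
  assumes "continuous_on {a..} g" "a \<le> t"
  shows "((\<lambda>u. integral {a..u} g) has_vector_derivative g t) (at t within {a..})"
proof -
  \<comment> \<open>Integrating up to \<open>t + 1\<close> keeps \<open>t\<close> away from the
    right end, so that the filters within \<open>{a..t + 1}\<close> and \<open>{a..}\<close> agree
    at \<open>t\<close>.\<close>
  have "continuous_on {a..t + 1} g"
    using assms(1) by (rule continuous_on_subset) auto
  from integral_has_vector_derivative[OF this, of t]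
  have "((\<lambda>u. integral {a..u} g) has_vector_derivative g t) (at t within {a..t + 1})"
    using \<open>a \<le> t\<close> by simp
  then show ?thesis
    using at_within_Icc_eq_at_within_Ici[of a t "t + 1"] \<open>a \<le> t\<close> by simp
qed

text \<open>Picard iteration contracts in the supremum norm weighted by the reciprocal of
  \<open>exp (2 * integral {0..t} L)\<close>, so one fixed point gives the solution on the whole half-line.\<close>

lemma global_solution_exists:
  fixes f :: "real \<Rightarrow> 'a::banach \<Rightarrow> 'a" and L :: "real \<Rightarrow> real"
  assumes f: "continuous_on ({0..} \<times> UNIV) (\<lambda>(t, x). f t x)"
    and L: "continuous_on {0..} L"
    and lip: "\<And>t x y. 0 \<le> t \<Longrightarrow> norm (f t x - f t y) \<le> L t * norm (x - y)"
    and f0: "\<And>t. 0 \<le> t \<Longrightarrow> norm (f t 0) \<le> L t"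
  obtains x where "x 0 = a"
    and "\<And>t. 0 \<le> t \<Longrightarrow> (x has_vector_derivative f t (x t)) (at t within {0..})"
proof -
  have L0: "0 \<le> L t" if "0 \<le> t" for t using f0[OF that] norm_ge_zero order_trans by blast
  define E where "E t = exp (2 * integral {0..t} L)" for t
  have dE: "(E has_vector_derivative 2 * (L t * E t)) (at t within {0..})" if "0 \<le> t" for t
  proof -
    note [derivative_intros] = integral_has_vector_derivative_halfline[OF L that,
        folded has_real_derivative_iff_has_vector_derivative]
    show ?thesis
      unfolding E_def has_real_derivative_iff_has_vector_derivative[symmetric]
      by (auto intro!: derivative_eq_intros)
  qed
  have E0: "E 0 = 1" by (simp add: E_def)
  have Epos: "0 < E t" for t by (simp add: E_def)
  have E1: "1 \<le> E t" if "0 \<le> t" for t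
    unfolding E_def using L0
    by (simp, intro integral_nonneg integrable_continuous_real continuous_on_subset[OF L]) auto
  have cE: "continuous_on {0..} E"
    unfolding continuous_on_eq_continuous_within
    using dE has_vector_derivative_continuous by blast
  \<comment> \<open>The derivative of \<open>E\<close> is \<open>2 * L * E\<close>, so
    \<open>L * E\<close> integrates to \<open>(E - 1) / 2\<close>: the factor 2 in the exponent is
    what gives the contraction constant \<open>1 / 2\<close>.\<close>
  have intLE: "((\<lambda>s. c * (L s * E s)) has_integral c * ((E t - 1) / 2)) {0..t}" if "0 \<le> t" for t c
  proof -
    have "((\<lambda>s. 2 * (L s * E s)) has_integral E t - E 0) {0..t}"
      using that by (intro fundamental_theorem_of_calculus has_vector_derivative_within_subset[OF dE]) auto
    from has_integral_mult_right[OF this, of "c / 2"] show ?thesis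
      by (simp add: E0 mult_ac)
  qed
  \<comment> \<open>The unknown is the rescaled solution \<open>u = x / E\<close>, which stays in
    the Banach space of bounded continuous functions even when \<open>x\<close> grows like
    \<open>E\<close>.\<close>
  define F where "F u s = f s (E s *\<^sub>R apply_bcontfun u s)" for u :: "real \<Rightarrow>\<^sub>C 'a" and s
  have cF: "continuous_on {0..} (F u)" for u
  proof -
    have "continuous_on {0..} (\<lambda>s. (s, E s *\<^sub>R apply_bcontfun u s))"
      by (intro continuous_intros cE continuous_on_apply_bcontfun)
    then have "continuous_on {0..} ((\<lambda>(t, x). f t x) \<circ> (\<lambda>s. (s, E s *\<^sub>R apply_bcontfun u s)))"
      by (rule continuous_on_compose) (auto intro: continuous_on_subset[OF f])
    then show ?thesis by (simp add: F_def[abs_def] o_def)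
  qed
  have iF: "F u integrable_on {0..t}" for u t
    by (intro integrable_continuous_real continuous_on_subset[OF cF]) auto
  define N where "N u t = a + integral {0..t} (F u)" for u t
  have dN: "(N u has_vector_derivative F u t) (at t within {0..})" if "0 \<le> t" for u t
    using integral_has_vector_derivative_halfline[OF cF that] unfolding N_def
    by (auto intro!: derivative_eq_intros)
  have cN: "continuous_on {0..} (N u)" for u
    unfolding continuous_on_eq_continuous_within
    using dN has_vector_derivative_continuous by blast
  \<comment> \<open>Elements of the function space live on all of \<open>real\<close>;
    \<open>max 0 t\<close> extends the rescaled iterate constantly to negative times.\<close>
  define H where "H u t = inverse (E (max 0 t)) *\<^sub>R N u (max 0 t)" for u t
  have Fdiff: "norm (F u s - F v s) \<le> norm (u - v) * (L s * E s)" if "0 \<le> s" for u v s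
  proof -
    have "norm (F u s - F v s) \<le> L s * norm (E s *\<^sub>R (u - v) s)"
      using lip[OF that, of "E s *\<^sub>R u s" "E s *\<^sub>R v s"] by (simp add: F_def scaleR_diff_right)
    also have "\<dots> \<le> L s * (E s * norm (u - v))"
      using norm_bounded[of "u - v" s] L0[OF that] Epos[of s] by (simp add: mult_left_mono)
    finally show ?thesis by (simp add: mult_ac)
  qed
  have F0: "norm (F 0 s) \<le> 1 * (L s * E s)" if "0 \<le> s" for s
    using f0[OF that] mult_left_mono[OF E1[OF that] L0[OF that]] by (simp add: F_def)
  have Ndiff: "norm (N u t - N v t) \<le> norm (u - v) * ((E t - 1) / 2)" if "0 \<le> t" for u v t
  proof -
    have "N u t - N v t = integral {0..t} (\<lambda>s. F u s - F v s)"
      by (simp add: N_def integral_diff iF)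
    also have "norm \<dots> \<le> integral {0..t} (\<lambda>s. norm (u - v) * (L s * E s))"
      using intLE[OF that] Fdiff
      by (intro integral_norm_bound_integral integrable_diff iF) (auto simp: has_integral_integrable_integral)
    finally show ?thesis by (simp only: integral_unique[OF intLE[OF that]])
  qed
  have N0: "norm (N 0 t) \<le> norm a + (E t - 1) / 2" if "0 \<le> t" for t
  proof -
    have "norm (integral {0..t} (F 0)) \<le> integral {0..t} (\<lambda>s. 1 * (L s * E s))"
      using intLE[OF that, of 1] F0
      by (intro integral_norm_bound_integral iF) (auto simp: has_integral_integrable_integral)
    then have "norm (integral {0..t} (F 0)) \<le> (E t - 1) / 2"
      unfolding integral_unique[OF intLE[OF that]] by simp
    then show ?thesis unfolding N_def by (rule norm_triangle_mono[OF order_refl])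
  qed
  have Hdiff: "norm (H u t - H v t) \<le> norm (u - v) / 2" for u v t
  proof -
    let ?t = "max 0 t"
    have "norm (H u t - H v t) = norm (N u ?t - N v ?t) / E ?t"
      using Epos[of ?t] by (simp add: H_def scaleR_diff_right[symmetric] divide_inverse)
    also have "\<dots> \<le> (norm (u - v) * (E ?t / 2)) / E ?t"
    proof (rule divide_right_mono)
      show "norm (N u ?t - N v ?t) \<le> norm (u - v) * (E ?t / 2)"
        by (rule order_trans[OF Ndiff]) (auto intro!: mult_left_mono)
    qed (use Epos[of ?t] in simp)
    finally show ?thesis using Epos[of ?t] by simp
  qed
  \<comment> \<open>Through \<open>N0\<close>, the growth bound \<open>f0\<close> makes the image of
    the zero function bounded; \<open>Hdiff\<close> then carries boundedness over to every
    \<open>u\<close>.\<close>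
  have H0: "norm (H 0 t) \<le> norm a + 1 / 2" for t
  proof -
    let ?t = "max 0 t"
    have "norm (H 0 t) = norm (N 0 ?t) / E ?t"
      using Epos[of ?t] by (simp add: H_def divide_inverse)
    also have "\<dots> \<le> (norm a * E ?t + E ?t / 2) / E ?t"
    proof (rule divide_right_mono)
      have "norm a * 1 \<le> norm a * E ?t" by (intro mult_left_mono E1) auto
      then show "norm (N 0 ?t) \<le> norm a * E ?t + E ?t / 2"
        using N0[of ?t] by (simp add: diff_divide_distrib)
    qed (use Epos[of ?t] in simp)
    finally show ?thesis using Epos[of ?t] by (simp add: add_divide_distrib)
  qed
  have Hb: "H u \<in> bcontfun" for u
  proof (rule bcontfun_normI)
    have max: "continuous_on UNIV (\<lambda>t. g (max 0 t))" if "continuous_on {0..} g" for g :: "real \<Rightarrow> 'b::topological_space"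
      by (rule continuous_on_compose2[OF that]) (auto intro!: continuous_intros)
    show "continuous_on UNIV (H u)"
      unfolding H_def using Epos
      by (intro continuous_intros max[OF cE] max[OF cN]) (auto simp: less_imp_neq[symmetric])
    show "norm (H u t) \<le> (norm a + 1 / 2) + norm (u - 0) / 2" for t
      using norm_triangle_mono[OF H0[of t] Hdiff[of u t 0]] by simp
  qed
  define P where "P u = Bcontfun (H u)" for u
  have P: "apply_bcontfun (P u) = H u" for u
    unfolding P_def by (rule Bcontfun_inverse[OF Hb])
  have "\<exists>!u. P u = u"
  proof (rule banach_fix_type)
    show "\<forall>u v. dist (P u) (P v) \<le> 1 / 2 * dist u v"
      using Hdiff by (intro allI dist_bound) (simp add: P dist_norm)
  qed auto
  then obtain u where "P u = u" by blast
  then have u: "apply_bcontfun u = H u" using P[of u] by simp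
  \<comment> \<open>At the fixed point \<open>E * u\<close> is the Picard iterate itself, so the
    integrand \<open>F u\<close> becomes \<open>f t (N u t)\<close>.\<close>
  have NE: "N u t = E t *\<^sub>R apply_bcontfun u t" if "0 \<le> t" for t
    using that Epos[of t] by (simp add: u H_def)
  show thesis
  proof
    show "N u 0 = a" by (simp add: N_def)
    show "(N u has_vector_derivative f t (N u t)) (at t within {0..})" if "0 \<le> t" for t
      using dN[OF that, of u] NE[OF that] by (simp add: F_def)
  qed
qed

section \<open>Lipschitz functions on bounded sets\<close>

text \<open>Only the existence of a constant is recorded, so that the closure rules chain under
  \<open>intro\<close> without tracking constants.\<close>

definition lipschitzian_on :: "'a::metric_space set \<Rightarrow> ('a \<Rightarrow> 'b::metric_space) \<Rightarrow> bool" where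
  "lipschitzian_on S f \<longleftrightarrow> (\<exists>C. C-lipschitz_on S f)"

named_theorems lipschitzian

lemma lipschitzian_on_const [lipschitzian]: "lipschitzian_on S (\<lambda>_. c)"
  unfolding lipschitzian_on_def using lipschitz_on_constant by blast

lemma lipschitzian_on_id [lipschitzian]: "lipschitzian_on S (\<lambda>x. x)"
  unfolding lipschitzian_on_def using lipschitz_on_id by blast

lemma lipschitzian_on_add [lipschitzian]:
  fixes f g :: "_ \<Rightarrow> 'b::real_normed_vector"
  shows "lipschitzian_on S f \<Longrightarrow> lipschitzian_on S g \<Longrightarrow> lipschitzian_on S (\<lambda>x. f x + g x)"
  unfolding lipschitzian_on_def using lipschitz_on_add by blast

lemma lipschitzian_on_minus [lipschitzian]:
  fixes f :: "_ \<Rightarrow> 'b::real_normed_vector"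
  shows "lipschitzian_on S f \<Longrightarrow> lipschitzian_on S (\<lambda>x. - f x)"
  unfolding lipschitzian_on_def using lipschitz_on_minus by blast

lemma lipschitzian_on_diff [lipschitzian]:
  fixes f g :: "_ \<Rightarrow> 'b::real_normed_vector"
  shows "lipschitzian_on S f \<Longrightarrow> lipschitzian_on S g \<Longrightarrow> lipschitzian_on S (\<lambda>x. f x - g x)"
  unfolding lipschitzian_on_def using lipschitz_on_diff by blast

lemma lipschitzian_on_Pair [lipschitzian]:
  "lipschitzian_on S f \<Longrightarrow> lipschitzian_on S g \<Longrightarrow> lipschitzian_on S (\<lambda>x. (f x, g x))"
  unfolding lipschitzian_on_def using lipschitz_on_Pair by blast

lemma lipschitzian_on_bounded_linear:
  assumes "bounded_linear h" "lipschitzian_on S f"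
  shows "lipschitzian_on S (\<lambda>x. h (f x))"
proof -
  obtain C where "C-lipschitz_on S f" using assms(2) by (auto simp: lipschitzian_on_def)
  moreover obtain B where "B-lipschitz_on (f ` S) h"
    using bounded_linear.lipschitz_boundE[OF assms(1)] .
  ultimately show ?thesis
    unfolding lipschitzian_on_def using lipschitz_on_compose2 by blast
qed

lemmas lipschitzian_on_fst [lipschitzian] = lipschitzian_on_bounded_linear[OF bounded_linear_fst]
lemmas lipschitzian_on_snd [lipschitzian] = lipschitzian_on_bounded_linear[OF bounded_linear_snd]
lemmas lipschitzian_on_matrix_vector [lipschitzian] =
  lipschitzian_on_bounded_linear[OF matrix_vector_mul_bounded_linear]

text \<open>Bounds the factors in the product rule below: over a bounded domain a Lipschitz map
  stays within a fixed distance of its value at any base point.\<close>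

lemma lipschitz_on_bounded:
  fixes k :: "'a::metric_space \<Rightarrow> 'b::real_normed_vector"
  assumes k: "C-lipschitz_on S k" and S: "bounded S"
  shows "\<exists>B\<ge>0. \<forall>x\<in>S. norm (k x) \<le> B"
proof -
  obtain a d where d: "\<And>x. x \<in> S \<Longrightarrow> dist a x \<le> d" using S by (auto simp: bounded_def)
  have "norm (k x) \<le> norm (k b) + C * (2 * \<bar>d\<bar>)" if "x \<in> S" "b \<in> S" for x b
  proof -
    have "dist x b \<le> 2 * \<bar>d\<bar>"
      using d[OF that(1)] d[OF that(2)] dist_triangle3[of x b a] by simp
    then have "dist (k x) (k b) \<le> C * (2 * \<bar>d\<bar>)"
      using lipschitz_onD[OF k that] lipschitz_on_nonneg[OF k] by (meson mult_left_mono order_trans)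
    then show ?thesis using norm_triangle_sub[of "k x" "k b"] by (simp add: dist_norm)
  qed
  then show ?thesis by (metis norm_ge_zero order_trans order_refl)
qed

text \<open>The increment splits into two terms, each with one difference and one plain factor;
  boundedness of \<open>S\<close> bounds the plain factor.\<close>

lemma lipschitzian_on_bounded_bilinear:
  fixes f :: "'a::metric_space \<Rightarrow> 'b::real_normed_vector" and g :: "'a \<Rightarrow> 'c::real_normed_vector"
  assumes h: "bounded_bilinear h" and S: "bounded S"
    and "lipschitzian_on S f" "lipschitzian_on S g"
  shows "lipschitzian_on S (\<lambda>x. h (f x) (g x))"
proof -
  interpret bounded_bilinear h by (rule h)
  obtain C1 C2 where C: "C1-lipschitz_on S f" "C2-lipschitz_on S g"
    using assms by (auto simp: lipschitzian_on_def)
  obtain B1 B2 where B: "0 \<le> B1" "\<And>x. x \<in> S \<Longrightarrow> norm (f x) \<le> B1"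
    "0 \<le> B2" "\<And>x. x \<in> S \<Longrightarrow> norm (g x) \<le> B2"
    using lipschitz_on_bounded[OF C(1) S] lipschitz_on_bounded[OF C(2) S] by blast
  obtain K where K: "0 \<le> K" "\<And>a b. norm (h a b) \<le> norm a * norm b * K"
    using nonneg_bounded by blast
  have C0: "0 \<le> C1" "0 \<le> C2" using C lipschitz_on_nonneg by blast+
  have "(C1 * B2 * K + B1 * C2 * K)-lipschitz_on S (\<lambda>x. h (f x) (g x))"
  proof (rule lipschitz_onI)
    fix x y assume xy: "x \<in> S" "y \<in> S"
    have "h (f x) (g x) - h (f y) (g y) = h (f x - f y) (g x) + h (f y) (g x - g y)"
      by (simp add: diff_left diff_right)
    then have "dist (h (f x) (g x)) (h (f y) (g y)) \<le> norm (h (f x - f y) (g x)) + norm (h (f y) (g x - g y))"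
      unfolding dist_norm using norm_triangle_ineq by simp
    also have "\<dots> \<le> norm (f x - f y) * norm (g x) * K + norm (f y) * norm (g x - g y) * K"
      by (intro add_mono K)
    also have "\<dots> \<le> (C1 * dist x y) * B2 * K + B1 * (C2 * dist x y) * K"
      using lipschitz_onD[OF C(1) xy] lipschitz_onD[OF C(2) xy] B xy K C0
      by (intro add_mono mult_mono mult_right_mono) (auto simp: dist_norm)
    finally show "dist (h (f x) (g x)) (h (f y) (g y)) \<le> (C1 * B2 * K + B1 * C2 * K) * dist x y"
      by (simp add: algebra_simps)
  qed (use B K C0 in auto)
  then show ?thesis by (auto simp: lipschitzian_on_def)
qed

lemmas lipschitzian_on_mult [lipschitzian] = lipschitzian_on_bounded_bilinear[OF bounded_bilinear_mult]
lemmas lipschitzian_on_scaleR [lipschitzian] = lipschitzian_on_bounded_bilinear[OF bounded_bilinear_scaleR]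
lemmas lipschitzian_on_inner [lipschitzian] = lipschitzian_on_bounded_bilinear[OF bounded_bilinear_inner]

section \<open>Quaternions and the error dynamics\<close>

lemma norm_quat_squared: "(norm (a :: quat))\<^sup>2 = (qscal a)\<^sup>2 + qvec a \<bullet> qvec a"
  unfolding power2_norm_eq_inner by (simp add: inner_prod_def power2_eq_square)

text \<open>With its companion, this makes left multiplications by a unit quaternion and by its
  conjugate mutually inverse, which is how \<open>q\<close> is recovered from the tracking
  error.\<close>

lemma qmul_cnj_left: "qcnj a \<otimes> (a \<otimes> b) = (norm a)\<^sup>2 *\<^sub>R b"
  unfolding norm_quat_squared
  by (simp add: qmul_def qcnj_def prod_eq_iff cross3_simps power2_eq_square forall_3)

lemma qmul_cnj_right: "a \<otimes> (qcnj a \<otimes> b) = (norm a)\<^sup>2 *\<^sub>R b"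
  unfolding norm_quat_squared
  by (simp add: qmul_def qcnj_def prod_eq_iff cross3_simps power2_eq_square forall_3)

lemma norm_qcnj: "norm (qcnj a) = norm a"
  by (simp add: norm_prod_def qcnj_def)

lemma norm_qmul: "norm (a \<otimes> b) = norm a * norm b"
proof (rule power2_eq_imp_eq)
  show "(norm (a \<otimes> b))\<^sup>2 = (norm a * norm b)\<^sup>2"
    unfolding power_mult_distrib norm_quat_squared
    by (simp add: qmul_def cross3_simps power2_eq_square)
qed auto

lemma bounded_bilinear_qmul: "bounded_bilinear (\<otimes>)"
proof -
  have "bilinear (\<otimes>)"
    unfolding bilinear_def
    by (auto intro!: linearI simp: qmul_def prod_eq_iff cross_add_left cross_add_right
        cross_mult_left cross_mult_right algebra_simps)
  then show ?thesis by (simp add: bilinear_conv_bounded_bilinear)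
qed

lemma qscal_err_q_rhs:
  "qscal (err_q_rhs \<alpha> w q e eW) = - (qvec e \<bullet> eW) / 2 - \<alpha> * ((norm q)\<^sup>2 - 1) * (1 + qscal e)"
  by (simp add: err_q_rhs_def qmul_def qpure_def qone_def inner_commute)

lemma qvec_err_q_rhs:
  "qvec (err_q_rhs \<alpha> w q e eW) =
     cross3 (qvec e) w + (1/2) *\<^sub>R ((1 + qscal e) *\<^sub>R eW + cross3 (qvec e) eW)
     - (\<alpha> * ((norm q)\<^sup>2 - 1)) *\<^sub>R qvec e"
  by (simp add: err_q_rhs_def qmul_def qpure_def qone_def cross3_simps forall_3)

text \<open>The commutator with the reference velocity is a cross product orthogonal to
  \<open>qvec e\<close>, so \<open>w\<close> drops out of the growth of
  \<open>norm e\<close>.\<close>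

lemma inner_err_q_rhs:
  "e \<bullet> err_q_rhs \<alpha> w q e eW =
     (qvec e \<bullet> eW) / 2 - \<alpha> * ((norm q)\<^sup>2 - 1) * (qscal e + (norm e)\<^sup>2)"
proof -
  have "e \<bullet> err_q_rhs \<alpha> w q e eW = qscal e * (- (qvec e \<bullet> eW) / 2 - \<alpha> * ((norm q)\<^sup>2 - 1) * (1 + qscal e))
      + qvec e \<bullet> (cross3 (qvec e) w + (1/2) *\<^sub>R ((1 + qscal e) *\<^sub>R eW + cross3 (qvec e) eW)
     - (\<alpha> * ((norm q)\<^sup>2 - 1)) *\<^sub>R qvec e)"
    unfolding inner_prod_def qscal_err_q_rhs qvec_err_q_rhs by simp
  then show ?thesis
    unfolding norm_quat_squared
    by (simp add: inner_add_right inner_diff_right dot_cross_self power2_eq_square field_simps)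
qed

text \<open>The rotational terms are orthogonal to \<open>qone + e\<close>; only the normalisation
  term changes its norm. This yields a scalar equation for the squared norm alone.\<close>

lemma inner_qone_add_err_q_rhs:
  "(qone + e) \<bullet> err_q_rhs \<alpha> w q e eW = - \<alpha> * ((norm q)\<^sup>2 - 1) * (norm (qone + e))\<^sup>2"
proof -
  have "(qone + e) \<bullet> err_q_rhs \<alpha> w q e eW =
      qscal (err_q_rhs \<alpha> w q e eW) + e \<bullet> err_q_rhs \<alpha> w q e eW"
    by (simp add: inner_prod_def qone_def distrib_right)
  then show ?thesis
    unfolding inner_err_q_rhs qscal_err_q_rhs norm_quat_squared
    by (simp add: qone_def power2_eq_square field_simps)
qed

lemma norm_qone_add: "(norm (qone + e))\<^sup>2 = 1 + 2 * qscal e + (norm e)\<^sup>2"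
  unfolding norm_quat_squared by (simp add: qone_def power2_eq_square algebra_simps)

text \<open>This and the next two rules exchange \<open>q\<close> for \<open>qone + e\<close>, which
  has the same norm because the reference is a unit quaternion.\<close>

lemma err_q_rhs_cong: "norm q = norm p \<Longrightarrow> err_q_rhs \<alpha> w q e eW = err_q_rhs \<alpha> w p e eW"
  by (simp add: err_q_rhs_def)

lemma eta_cong: "norm q = norm p \<Longrightarrow> eta kq \<alpha> q e = eta kq \<alpha> p e"
  by (simp add: eta_def)

lemma eta_dot_cong: "norm q = norm p \<Longrightarrow> eta_dot kq \<alpha> w q e eW = eta_dot kq \<alpha> w p e eW"
  using err_q_rhs_cong[of q p] by (simp add: eta_dot_def)

lemma has_vector_derivative_power2_norm:
  fixes f :: "real \<Rightarrow> 'a::real_inner"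
  assumes "(f has_vector_derivative f') (at t within S)"
  shows "((\<lambda>t. (norm (f t))\<^sup>2) has_vector_derivative 2 * (f t \<bullet> f')) (at t within S)"
  using bounded_bilinear.has_vector_derivative[OF bounded_bilinear_inner assms assms]
  by (simp add: power2_norm_eq_inner inner_commute)

lemma norm_qone_add_derivative:
  assumes "(e has_vector_derivative err_q_rhs \<alpha> w (qone + e t) (e t) eW) (at t within S)"
  shows "((\<lambda>t. (norm (qone + e t))\<^sup>2) has_vector_derivative
           - 2 * \<alpha> * ((norm (qone + e t))\<^sup>2 - 1) * (norm (qone + e t))\<^sup>2) (at t within S)"
proof -
  have "((\<lambda>t. qone + e t) has_vector_derivative err_q_rhs \<alpha> w (qone + e t) (e t) eW) (at t within S)"
    using has_vector_derivative_add[OF has_vector_derivative_const assms, of qone] by simp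
  from has_vector_derivative_power2_norm[OF this] show ?thesis
    unfolding inner_qone_add_err_q_rhs by (simp only: mult.assoc[symmetric] mult_minus_left mult_minus_right)
qed

text \<open>The product rule, with \<open>norm_qone_add_derivative\<close> for the squared norm
  inside the coefficient. It lets the feedback term \<open>eta_dot\<close> cancel the drift of
  \<open>eta\<close>.\<close>

lemma eta_derivative:
  assumes e: "(e has_vector_derivative err_q_rhs \<alpha> w (qone + e t) (e t) eW) (at t within S)"
  shows "((\<lambda>t. eta kq \<alpha> (qone + e t) (e t)) has_vector_derivative
           eta_dot kq \<alpha> w (qone + e t) (e t) eW) (at t within S)"
proof -
  let ?d = "err_q_rhs \<alpha> w (qone + e t) (e t) eW" and ?n = "(norm (qone + e t))\<^sup>2"
  have s: "((\<lambda>t. qscal (e t)) has_vector_derivative qscal ?d) (at t within S)"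
    by (rule bounded_linear.has_vector_derivative[OF bounded_linear_fst e])
  have v: "((\<lambda>t. qvec (e t)) has_vector_derivative qvec ?d) (at t within S)"
    by (rule bounded_linear.has_vector_derivative[OF bounded_linear_snd e])
  have g: "((\<lambda>t. 2 * \<alpha> * (qscal (e t) + (norm (qone + e t))\<^sup>2 - 1)) has_vector_derivative
      2 * \<alpha> * (qscal ?d - 2 * \<alpha> * (?n - 1) * ?n)) (at t within S)"
    using bounded_linear.has_vector_derivative[OF bounded_linear_mult_right[of "2 * \<alpha>"]
        has_vector_derivative_diff[OF has_vector_derivative_add[OF s norm_qone_add_derivative[OF e]]
          has_vector_derivative_const[of 1]]]
    by (simp add: mult.assoc)
  have "((\<lambda>t. - (kq *\<^sub>R qvec (e t)) + (2 * \<alpha> * (qscal (e t) + (norm (qone + e t))\<^sup>2 - 1)) *\<^sub>R qvec (e t))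
      has_vector_derivative - (kq *\<^sub>R qvec ?d) +
       ((2 * \<alpha> * (qscal (e t) + ?n - 1)) *\<^sub>R qvec ?d
        + (2 * \<alpha> * (qscal ?d - 2 * \<alpha> * (?n - 1) * ?n)) *\<^sub>R qvec (e t))) (at t within S)"
    by (intro has_vector_derivative_add has_vector_derivative_minus
        bounded_linear.has_vector_derivative[OF bounded_linear_scaleR_right v]
        bounded_bilinear.has_vector_derivative[OF bounded_bilinear_scaleR g v])
  then show ?thesis
    by (simp only: eta_def eta_dot_def Let_def add.assoc)
qed

text \<open>Positive definiteness leaves no kernel, hence an inverse; symmetry passes to it because
  its transpose is also a left inverse of \<open>J\<close>.\<close>

lemma matrix_inv_inertia:
  assumes "inertia_matrix J"
  shows "matrix_inv J *v (J *v x) = x" "J *v (matrix_inv J *v x) = x"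
    and "transpose (matrix_inv J) = matrix_inv J"
proof -
  have "\<forall>x. J *v x = 0 \<longrightarrow> x = 0"
    using assms unfolding inertia_matrix_def by (metis inner_zero_right less_irrefl)
  then have "invertible J"
    by (simp add: invertible_left_inverse matrix_left_invertible_ker)
  then have inv: "J ** matrix_inv J = mat 1" "matrix_inv J ** J = mat 1"
    using someI_ex[of "\<lambda>A'. J ** A' = mat 1 \<and> A' ** J = mat 1"]
    by (simp_all add: matrix_inv_def invertible_def)
  then show "matrix_inv J *v (J *v x) = x" "J *v (matrix_inv J *v x) = x"
    by (simp_all add: matrix_vector_mul_assoc)
  have "transpose (matrix_inv J) ** J = mat 1"
    using arg_cong[OF inv(1), of transpose] assms
    by (simp add: matrix_transpose_mul transpose_mat inertia_matrix_def)
  then have "transpose (matrix_inv J) ** (J ** matrix_inv J) = matrix_inv J"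
    by (simp add: matrix_mul_assoc)
  then show "transpose (matrix_inv J) = matrix_inv J" by (simp add: inv)
qed

text \<open>Lagrange's identity with the squared inner product dropped.\<close>

lemma norm_cross3_le: "norm (cross3 a b) \<le> norm a * norm b"
proof (rule power2_le_imp_le)
  show "(norm (cross3 a b))\<^sup>2 \<le> (norm a * norm b)\<^sup>2"
    unfolding norm_cross_dot[symmetric] by simp
qed simp

lemmas lipschitzian_on_qmul [lipschitzian] = lipschitzian_on_bounded_bilinear[OF bounded_bilinear_qmul]

lemma continuous_on_qmul [continuous_intros]:
  "continuous_on S f \<Longrightarrow> continuous_on S g \<Longrightarrow> continuous_on S (\<lambda>x. f x \<otimes> g x)"
  by (rule bounded_bilinear.continuous_on[OF bounded_bilinear_qmul])

lemma continuous_on_qpure [continuous_intros]: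
  "continuous_on S f \<Longrightarrow> continuous_on S (\<lambda>x. qpure (f x))"
  unfolding qpure_def by (intro continuous_intros)

lemma continuous_on_eta [continuous_intros]:
  "continuous_on S q \<Longrightarrow> continuous_on S e \<Longrightarrow> continuous_on S (\<lambda>x. eta kq \<alpha> (q x) (e x))"
  unfolding eta_def by (intro continuous_intros)

lemma continuous_on_matrix_vector [continuous_intros]:
  fixes A :: "real^'n^'m"
  shows "continuous_on S f \<Longrightarrow> continuous_on S (\<lambda>x. A *v f x)"
  by (rule bounded_linear.continuous_on[OF matrix_vector_mul_bounded_linear])

section \<open>The Lyapunov function\<close>

text \<open>The closed loop in the coordinates \<open>e = e\<^sub>q\<close>, \<open>z = e\<^sub>\<Omega> - \<eta>\<close>, \<open>y = \<Delta> - \<Delta>'\<close>, where \<open>\<Delta>'\<close> is the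
  disturbance estimate. The reference enters only through \<open>w = \<Omega>\<^sub>0\<close>, and \<open>q\<close> only through
  \<open>norm q = norm (qone + e)\<close>.\<close>

type_synonym err_state = "quat \<times> (real^3) \<times> (real^3)"

text \<open>\<open>A\<close> stands for the inverse inertia matrix; its symmetry lets the
  disturbance terms in the Lyapunov derivative cancel.\<close>

locale tracking_gains =
  fixes k1 kq kW kD \<alpha> :: real and A :: "real^3^3"
  assumes gains_pos: "k1 > 0" "kq > 0" "kW > 0" "kD > 0" "\<alpha> > 0"
    and transpose_A: "transpose A = A"
begin

definition err_field :: "real^3 \<Rightarrow> err_state \<Rightarrow> err_state" where
  "err_field w = (\<lambda>(e, z, y).
     (err_q_rhs \<alpha> w (qone + e) e (z + eta kq \<alpha> (qone + e) e),
      - (k1 *\<^sub>R qvec e) - kW *\<^sub>R z + A *v y,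
      - ((kD / (2 * k1)) *\<^sub>R (A *v z))))"

definition lyap :: "err_state \<Rightarrow> real" where
  "lyap = (\<lambda>(e, z, y). 1/2 * (norm e)\<^sup>2 + 1 / (4 * k1) * (norm z)\<^sup>2 + 1 / (2 * kD) * (norm y)\<^sup>2)"

definition lyap_rate :: "err_state \<Rightarrow> real" where
  "lyap_rate = (\<lambda>(e, z, y). - (kq / 2) * (norm (qvec e))\<^sup>2
     - \<alpha> * (qscal e)\<^sup>2 * (1 + qscal e + (norm (qone + e))\<^sup>2) - kW / (2 * k1) * (norm z)\<^sup>2)"

lemma continuous_on_err_field:
  assumes "continuous_on S w" "continuous_on S x"
  shows "continuous_on S (\<lambda>p. err_field (w p) (x p))"
  unfolding err_field_def err_q_rhs_def split_beta by (intro continuous_intros assms)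

lemma continuous_on_lyap: "continuous_on S lyap"
  unfolding lyap_def split_beta by (intro continuous_intros)

text \<open>Isolates the reference in one term linear in the state: a Lipschitz constant of the
  autonomous field \<open>err_field 0\<close> on a bounded set then serves at all times, with
  \<open>norm w\<close> added.\<close>

lemma err_field_split: "err_field w x = ((0, cross3 (qvec (fst x)) w), 0, 0) + err_field 0 x"
proof -
  have "err_q_rhs \<alpha> w q e eW = (0, cross3 (qvec e) w) + err_q_rhs \<alpha> 0 q e eW" for q e eW
    by (simp add: prod_eq_iff qscal_err_q_rhs qvec_err_q_rhs)
  then show ?thesis by (auto simp: err_field_def split_beta)
qed

lemma lipschitz_err_field:
  assumes "bounded S"
  obtains C where "0 \<le> C"
    and "\<And>w x y. \<lbrakk>x \<in> S; y \<in> S\<rbrakk> \<Longrightarrow> norm (err_field w x - err_field w y) \<le> (norm w + C) * norm (x - y)"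
proof -
  \<comment> \<open>Discharges the boundedness premise of the bilinear rules during
    \<open>intro lipschitzian\<close>.\<close>
  note [lipschitzian] = assms
  have "lipschitzian_on S (err_field 0)"
    unfolding err_field_def err_q_rhs_def eta_def qpure_def split_beta power2_norm_eq_inner
    by (intro lipschitzian)
  then obtain C where C: "C-lipschitz_on S (err_field 0)" by (auto simp: lipschitzian_on_def)
  show thesis
  proof
    show "0 \<le> C" using C by (rule lipschitz_on_nonneg)
    fix w x y assume xy: "x \<in> S" "y \<in> S"
    have "err_field w x - err_field w y =
        ((0, cross3 (qvec (fst (x - y))) w), 0, 0) + (err_field 0 x - err_field 0 y)"
      unfolding err_field_split[of w x] err_field_split[of w y]
      by (simp add: prod_eq_iff Cross3.left_diff_distrib)
    also have "norm \<dots> \<le> norm (qvec (fst (x - y))) * norm w + C * norm (x - y)"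
      using lipschitz_onD[OF C xy]
      by (intro norm_triangle_mono) (simp_all add: dist_norm norm_Pair norm_cross3_le)
    also have "\<dots> \<le> norm (x - y) * norm w + C * norm (x - y)"
      using norm_snd_le[of "qvec (fst (x - y))" "qscal (fst (x - y))"]
        norm_fst_le[of "fst (x - y)" "snd (x - y)"]
      unfolding prod.collapse by (intro add_right_mono mult_right_mono) auto
    finally show "norm (err_field w x - err_field w y) \<le> (norm w + C) * norm (x - y)"
      by (simp only: distrib_right mult.commute)
  qed
qed

text \<open>Meets the condition on \<open>f t 0\<close> in \<open>global_solution_exists\<close>: at
  zero error \<open>norm qone = 1\<close> switches the normalisation term off.\<close>

lemma err_field_0: "err_field w 0 = 0"
proof -
  have "norm qone = 1" by (simp add: qone_def norm_Pair)
  then have "err_q_rhs \<alpha> w qone 0 0 = 0"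
    by (intro prod_eqI) (simp_all add: qscal_err_q_rhs qvec_err_q_rhs)
  then show ?thesis by (intro prod_eqI) (simp_all add: err_field_def split_beta eta_def)
qed

lemma inner_A: "z \<bullet> (A *v y) = y \<bullet> (A *v z)"
  by (metis dot_lmul_matrix inner_commute transpose_A vector_transpose_matrix)

text \<open>The weights in \<open>lyap\<close> match the gains: the terms in
  \<open>qvec e \<bullet> z\<close> cancel between the first two summands and, as \<open>A\<close>
  is symmetric, those in \<open>y \<bullet> (A *v z)\<close> between the last two.\<close>

lemma lyap_derivative:
  assumes x: "(x has_vector_derivative err_field w (x t)) (at t within S)"
  shows "((\<lambda>t. lyap (x t)) has_vector_derivative lyap_rate (x t)) (at t within S)"
proof -
  obtain e z y where xt: "x t = (e, z, y)" by (cases "x t")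
  let ?eta = "eta kq \<alpha> (qone + e) e"
  have d1: "((\<lambda>t. fst (x t)) has_vector_derivative err_q_rhs \<alpha> w (qone + e) e (z + ?eta)) (at t within S)"
    using bounded_linear.has_vector_derivative[OF bounded_linear_fst x] by (simp add: err_field_def xt)
  note d = bounded_linear.has_vector_derivative[OF bounded_linear_snd x]
  have d2: "((\<lambda>t. fst (snd (x t))) has_vector_derivative
      - (k1 *\<^sub>R qvec e) - kW *\<^sub>R z + A *v y) (at t within S)"
    using bounded_linear.has_vector_derivative[OF bounded_linear_fst d] by (simp add: err_field_def xt)
  have d3: "((\<lambda>t. snd (snd (x t))) has_vector_derivative - ((kD / (2 * k1)) *\<^sub>R (A *v z))) (at t within S)"
    using bounded_linear.has_vector_derivative[OF bounded_linear_snd d] by (simp add: err_field_def xt)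
  have "((\<lambda>t. lyap (x t)) has_vector_derivative
      1/2 * (2 * (e \<bullet> err_q_rhs \<alpha> w (qone + e) e (z + ?eta)))
      + 1 / (4 * k1) * (2 * (z \<bullet> (- (k1 *\<^sub>R qvec e) - kW *\<^sub>R z + A *v y)))
      + 1 / (2 * kD) * (2 * (y \<bullet> - ((kD / (2 * k1)) *\<^sub>R (A *v z))))) (at t within S)"
    unfolding lyap_def split_beta
    using has_vector_derivative_power2_norm[OF d1] has_vector_derivative_power2_norm[OF d2]
      has_vector_derivative_power2_norm[OF d3]
    by (intro has_vector_derivative_add bounded_linear.has_vector_derivative[OF bounded_linear_mult_right])
      (simp_all add: xt)
  moreover have "1/2 * (2 * (e \<bullet> err_q_rhs \<alpha> w (qone + e) e (z + ?eta)))
      + 1 / (4 * k1) * (2 * (z \<bullet> (- (k1 *\<^sub>R qvec e) - kW *\<^sub>R z + A *v y)))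
      + 1 / (2 * kD) * (2 * (y \<bullet> - ((kD / (2 * k1)) *\<^sub>R (A *v z)))) = lyap_rate (x t)"
  proof -
    define s where "s = qscal e"
    define p where "p = qvec e \<bullet> qvec e"
    have n: "(norm (qone + e))\<^sup>2 = 1 + 2 * s + s\<^sup>2 + p" and ne: "(norm e)\<^sup>2 = s\<^sup>2 + p"
      unfolding norm_qone_add by (simp_all add: norm_quat_squared s_def p_def)
    have eta: "qvec e \<bullet> ?eta = (2 * \<alpha> * (s + (norm (qone + e))\<^sup>2 - 1) - kq) * p"
      by (simp add: eta_def s_def p_def inner_add_right algebra_simps)
    \<comment> \<open>The part of \<open>eta\<close> with factor \<alpha> is designed for this:
      after inserting \<open>n\<close>, it combines with the normalisation terms into a multiple of
      \<open>s\<^sup>2\<close>.\<close>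
    have "e \<bullet> err_q_rhs \<alpha> w (qone + e) e (z + ?eta) =
        (qvec e \<bullet> z) / 2 - kq / 2 * p - \<alpha> * s\<^sup>2 * (1 + s + (norm (qone + e))\<^sup>2)"
      unfolding inner_err_q_rhs inner_add_right eta ne n s_def[symmetric]
      by (simp add: power2_eq_square field_simps)
    moreover have "1 / (4 * k1) * (2 * (z \<bullet> (- (k1 *\<^sub>R qvec e) - kW *\<^sub>R z + A *v y)))
        = - (qvec e \<bullet> z) / 2 - kW / (2 * k1) * (z \<bullet> z) + y \<bullet> (A *v z) / (2 * k1)"
      using gains_pos by (simp add: inner_add_right inner_diff_right inner_A[of z y] inner_commute[of z "qvec e"] field_simps)
    moreover have "1 / (2 * kD) * (2 * (y \<bullet> - ((kD / (2 * k1)) *\<^sub>R (A *v z)))) = - (y \<bullet> (A *v z)) / (2 * k1)"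
      using gains_pos by simp
    ultimately show ?thesis
      by (simp add: lyap_rate_def xt power2_norm_eq_inner[of z] power2_norm_eq_inner[of "qvec e"]
          s_def p_def diff_divide_distrib)
  qed
  ultimately show ?thesis by simp
qed

section \<open>The invariant region\<close>

definition region :: "real \<Rightarrow> real \<Rightarrow> err_state set" where
  "region c \<epsilon> = {x. lyap x \<le> c \<and> \<bar>(norm (qone + fst x))\<^sup>2 - 1\<bar> \<le> \<epsilon>}"

lemma closed_region: "closed (region c \<epsilon>)"
  unfolding region_def
  by (intro closed_Collect_conj closed_Collect_le continuous_intros continuous_on_lyap)

lemma region_norms:
  assumes "x \<in> region c \<epsilon>"
  shows "(norm (fst x))\<^sup>2 \<le> 2 * c" "(norm (fst (snd x)))\<^sup>2 \<le> 4 * k1 * c" "(norm (snd (snd x)))\<^sup>2 \<le> 2 * kD * c"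
proof -
  have l: "(norm (fst x))\<^sup>2 / 2 + (norm (fst (snd x)))\<^sup>2 / (4 * k1) + (norm (snd (snd x)))\<^sup>2 / (2 * kD) \<le> c"
    using assms by (simp add: region_def lyap_def split_beta)
  have p: "0 \<le> (norm (fst (snd x)))\<^sup>2 / (4 * k1)" "0 \<le> (norm (snd (snd x)))\<^sup>2 / (2 * kD)" "0 \<le> (norm (fst x))\<^sup>2 / 2"
    using gains_pos by simp_all
  have "(norm (fst (snd x)))\<^sup>2 / (4 * k1) \<le> c" "(norm (snd (snd x)))\<^sup>2 / (2 * kD) \<le> c"
    using l p by linarith+
  then show "(norm (fst (snd x)))\<^sup>2 \<le> 4 * k1 * c" "(norm (snd (snd x)))\<^sup>2 \<le> 2 * kD * c"
    using gains_pos by (simp_all add: divide_le_eq mult_ac)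
  show "(norm (fst x))\<^sup>2 \<le> 2 * c" using l p by linarith
qed

lemma bounded_region: "bounded (region c \<epsilon>)"
proof (rule boundedI)
  fix x assume "x \<in> region c \<epsilon>"
  note b = region_norms[OF this]
  have "(norm x)\<^sup>2 = (norm (fst x))\<^sup>2 + (norm (fst (snd x)))\<^sup>2 + (norm (snd (snd x)))\<^sup>2"
    by (simp add: norm_prod_def)
  with b have "(norm x)\<^sup>2 \<le> 2 * c + 4 * k1 * c + 2 * kD * c" by linarith
  then show "norm x \<le> sqrt (2 * c + 4 * k1 * c + 2 * kD * c)" by (rule real_le_rsqrt)
qed

lemma region_damping:
  assumes "x \<in> region c \<epsilon>"
  shows "2 - sqrt (2 * c) - \<epsilon> \<le> 1 + qscal (fst x) + (norm (qone + fst x))\<^sup>2"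
proof -
  have "norm (fst x) \<le> sqrt (2 * c)" using region_norms(1)[OF assms] by (rule real_le_rsqrt)
  moreover have "\<bar>qscal (fst x)\<bar> \<le> norm (fst x)" using norm_fst_le[of "fst (fst x)" "snd (fst x)"] by simp
  moreover have "1 - \<epsilon> \<le> (norm (qone + fst x))\<^sup>2" using assms by (auto simp: region_def abs_le_iff)
  ultimately show ?thesis by linarith
qed

lemma lyap_rate_nonpos:
  assumes "0 \<le> 1 + qscal (fst x) + (norm (qone + fst x))\<^sup>2"
  shows "lyap_rate x \<le> 0"
proof -
  have "0 \<le> \<alpha> * (qscal (fst x))\<^sup>2 * (1 + qscal (fst x) + (norm (qone + fst x))\<^sup>2)"
    "0 \<le> (kq / 2) * (norm (qvec (fst x)))\<^sup>2" "0 \<le> kW / (2 * k1) * (norm (fst (snd x)))\<^sup>2"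
    using assms gains_pos by simp_all
  then show ?thesis by (simp add: lyap_rate_def split_beta)
qed

text \<open>The equation is demanded only inside the ball of radius \<open>R\<close>, so that
  solutions of a field truncated outside that ball are covered too.\<close>

lemma region_invariant:
  assumes cont: "continuous_on {0..} x"
    and x0: "x 0 \<in> region c \<epsilon>"
    and \<epsilon>: "\<epsilon> < 2 - sqrt (2 * c)"
    and R: "\<And>u. u \<in> region c \<epsilon> \<Longrightarrow> norm u < R"
    and der: "\<And>t. \<lbrakk>0 \<le> t; norm (x t) < R\<rbrakk> \<Longrightarrow>
      (x has_vector_derivative err_field (w t) (x t)) (at t within {0..})"
    and "0 \<le> t"
  shows "x t \<in> region c \<epsilon>"
proof (rule invariant_barrier[OF cont closed_region _ _ x0 _ \<open>0 \<le> t\<close>])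
  \<comment> \<open>Strict inequalities make \<open>U\<close> open: inside the ball the equation
    holds, and a positive damping factor keeps \<open>lyap\<close> from growing.\<close>
  define U where "U = {u :: err_state. norm u < R \<and> 0 < 1 + qscal (fst u) + (norm (qone + fst u))\<^sup>2}"
  show "open U"
    unfolding U_def by (intro open_Collect_conj open_Collect_less continuous_intros)
  show "region c \<epsilon> \<subseteq> U"
    using R region_damping \<epsilon> by (fastforce simp: U_def)
  fix a b assume ab: "0 \<le> a" "a \<le> b" and xa: "x a \<in> region c \<epsilon>"
    and xU: "\<And>t. \<lbrakk>a \<le> t; t \<le> b\<rbrakk> \<Longrightarrow> x t \<in> U"
  have d: "(x has_vector_derivative err_field (w t) (x t)) (at t within {0..})" if "a \<le> t" "t \<le> b" for t
    using der[of t] xU[OF that] that ab by (simp add: U_def)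
  have "lyap (x b) \<le> lyap (x a)"
  proof (rule nonincreasing_on_halfline[where f = "\<lambda>t. lyap (x t)" and f' = "\<lambda>t. lyap_rate (x t)", OF ab])
    fix t assume t: "a \<le> t" "t \<le> b"
    show "((\<lambda>t. lyap (x t)) has_vector_derivative lyap_rate (x t)) (at t within {0..})"
      by (rule lyap_derivative[OF d[OF t]])
    show "lyap_rate (x t) \<le> 0"
      using xU[OF t] by (intro lyap_rate_nonpos) (simp add: U_def)
  qed
  \<comment> \<open>Squaring the deviation keeps it differentiable. The squared norm
    \<open>n\<close> has derivative \<open>- 2 * \<alpha> * (n - 1) * n\<close>, which always points
    towards 1.\<close>
  moreover have "((norm (qone + fst (x b)))\<^sup>2 - 1)\<^sup>2 \<le> ((norm (qone + fst (x a)))\<^sup>2 - 1)\<^sup>2"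
  proof (rule nonincreasing_on_halfline[where f = "\<lambda>t. ((norm (qone + fst (x t)))\<^sup>2 - 1)\<^sup>2" and
        f' = "\<lambda>t. - (4 * \<alpha> * ((norm (qone + fst (x t)))\<^sup>2 - 1)\<^sup>2 * (norm (qone + fst (x t)))\<^sup>2)", OF ab])
    fix t assume t: "a \<le> t" "t \<le> b"
    have "((\<lambda>t. fst (x t)) has_vector_derivative
        err_q_rhs \<alpha> (w t) (qone + fst (x t)) (fst (x t)) (fst (snd (x t)) + eta kq \<alpha> (qone + fst (x t)) (fst (x t))))
        (at t within {0..})"
      using bounded_linear.has_vector_derivative[OF bounded_linear_fst d[OF t]]
      by (simp add: err_field_def split_beta)
    note d2 = has_vector_derivative_power2_norm[OF has_vector_derivative_diff[OF norm_qone_add_derivative[OF this]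
        has_vector_derivative_const[of 1]]]
    have eq: "2 * ((n - 1) \<bullet> (- 2 * \<alpha> * (n - 1) * n - 0)) = - (4 * \<alpha> * (n - 1)\<^sup>2 * n)" for n :: real
      by (simp add: power2_eq_square algebra_simps)
    show "((\<lambda>t. ((norm (qone + fst (x t)))\<^sup>2 - 1)\<^sup>2) has_vector_derivative
        - (4 * \<alpha> * ((norm (qone + fst (x t)))\<^sup>2 - 1)\<^sup>2 * (norm (qone + fst (x t)))\<^sup>2)) (at t within {0..})"
      using d2 by (simp only: eq real_norm_def power2_abs)
    show "- (4 * \<alpha> * ((norm (qone + fst (x t)))\<^sup>2 - 1)\<^sup>2 * (norm (qone + fst (x t)))\<^sup>2) \<le> 0"
      using gains_pos by simp
  qed
  then have "\<bar>(norm (qone + fst (x b)))\<^sup>2 - 1\<bar> \<le> \<bar>(norm (qone + fst (x a)))\<^sup>2 - 1\<bar>"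
    by (simp only: abs_le_square_iff)
  ultimately show "x b \<in> region c \<epsilon>" using xa by (simp add: region_def)
qed

section \<open>Existence and convergence in error coordinates\<close>

text \<open>Composing the field with the projection onto a ball around the region makes it globally
  Lipschitz at each time. The global solution so obtained stays in the region by invariance, where
  the projection is the identity.\<close>

lemma err_field_solution_exists:
  assumes w: "continuous_on {0..} w" and u: "u \<in> region c \<epsilon>" and \<epsilon>: "\<epsilon> < 2 - sqrt (2 * c)"
  obtains x where "x 0 = u"
    and "\<And>t. 0 \<le> t \<Longrightarrow> (x has_vector_derivative err_field (w t) (x t)) (at t within {0..})"
proof -
  obtain R0 where R0: "0 < R0" "\<And>v. v \<in> region c \<epsilon> \<Longrightarrow> norm v \<le> R0"
    using bounded_region[of c \<epsilon>] by (auto simp: bounded_pos)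
  \<comment> \<open>The extra 1 puts the region into the open ball, as
    \<open>region_invariant\<close> needs a strict bound.\<close>
  define R where "R = R0 + 1"
  have R: "0 < R" "\<And>v. v \<in> region c \<epsilon> \<Longrightarrow> norm v < R"
    using R0 by (fastforce simp: R_def)+
  define P where "P = closest_point (cball (0 :: err_state) R)"
  have P: "P v \<in> cball 0 R" for v
    unfolding P_def using R(1) by (intro closest_point_in_set) auto
  have P_self: "P v = v" if "norm v \<le> R" for v
    unfolding P_def using that by (intro closest_point_self) auto
  have P_lip: "norm (P v - P v') \<le> norm (v - v')" for v v'
    unfolding P_def dist_norm[symmetric] using R(1) by (intro closest_point_lipschitz) auto
  have P_cont: "continuous_on UNIV P"
    unfolding P_def using R(1) by (intro continuous_on_closest_point) auto
  obtain C where C: "0 \<le> C" "\<And>w x y. \<lbrakk>x \<in> cball 0 R; y \<in> cball 0 R\<rbrakk> \<Longrightarrow>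
      norm (err_field w x - err_field w y) \<le> (norm w + C) * norm (x - y)"
    using lipschitz_err_field[OF bounded_cball] by blast
  obtain x where x0: "x 0 = u"
    and x: "\<And>t. 0 \<le> t \<Longrightarrow> (x has_vector_derivative err_field (w t) (P (x t))) (at t within {0..})"
  proof (rule global_solution_exists[where a = u and f = "\<lambda>t v. err_field (w t) (P v)" and L = "\<lambda>t. norm (w t) + C"])
    show "continuous_on ({0..} \<times> UNIV) (\<lambda>(t, v). err_field (w t) (P v))"
      unfolding split_beta
      by (intro continuous_on_err_field continuous_on_compose2[OF w] continuous_on_compose2[OF P_cont]
          continuous_intros) auto
    show "continuous_on {0..} (\<lambda>t. norm (w t) + C)" by (intro continuous_intros w)
    fix t v v'
    have "norm (err_field (w t) (P v) - err_field (w t) (P v')) \<le> (norm (w t) + C) * norm (P v - P v')"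
      by (rule C(2)[OF P P])
    also have "\<dots> \<le> (norm (w t) + C) * norm (v - v')"
      using C(1) by (intro mult_left_mono P_lip) simp
    finally show "norm (err_field (w t) (P v) - err_field (w t) (P v')) \<le> (norm (w t) + C) * norm (v - v')" .
    show "norm (err_field (w t) (P 0)) \<le> norm (w t) + C"
      using C(1) R(1) P_self[of 0] by (simp add: err_field_0)
  qed (use that in blast)
  have "continuous_on {0..} x"
    unfolding continuous_on_eq_continuous_within
    using x has_vector_derivative_continuous by blast
  then have "x t \<in> region c \<epsilon>" if "0 \<le> t" for t
  proof (rule region_invariant[OF _ _ \<epsilon> R(2), where w = w])
    fix t assume "0 \<le> t" "norm (x t) < R"
    then show "(x has_vector_derivative err_field (w t) (x t)) (at t within {0..})"
      using x[of t] P_self[of "x t"] by simp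
  qed (use x0 u that in auto)
  then have "P (x t) = x t" if "0 \<le> t" for t
    using R(2) P_self that less_imp_le by blast
  then show thesis using that[of x] x x0 by simp
qed

text \<open>\<open>lyap_rate\<close> controls \<open>e\<close> and \<open>z\<close> but not
  \<open>y\<close>, so \<open>lyapunov_rate_tendsto_0\<close> is applied to the sum \<open>g\<close>
  of the first two squared norms.\<close>

lemma err_field_solution_tendsto_0:
  assumes x: "\<And>t. 0 \<le> t \<Longrightarrow> (x has_vector_derivative err_field (w t) (x t)) (at t within {0..})"
    and x0: "x 0 \<in> region c \<epsilon>" and \<epsilon>: "\<epsilon> < 2 - sqrt (2 * c)"
  shows "((\<lambda>t. fst (x t)) \<longlongrightarrow> 0) at_top" "((\<lambda>t. fst (snd (x t))) \<longlongrightarrow> 0) at_top"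
proof -
  obtain R where R: "\<And>v. v \<in> region c \<epsilon> \<Longrightarrow> norm v \<le> R"
    using bounded_region[of c \<epsilon>] by (auto simp: bounded_iff)
  have "continuous_on {0..} x"
    unfolding continuous_on_eq_continuous_within
    using x has_vector_derivative_continuous by blast
  then have inv: "x t \<in> region c \<epsilon>" if "0 \<le> t" for t
    by (rule region_invariant[OF _ x0 \<epsilon> _ x that, where R = "R + 1"]) (use R in fastforce)
  \<comment> \<open>The smallest of the damping coefficients of \<open>lyap_rate\<close> on the
    region, so that the rate is at most \<open>- \<kappa> * g\<close>.\<close>
  define \<kappa> where "\<kappa> = Min {kq / 2, \<alpha> * (2 - sqrt (2 * c) - \<epsilon>), kW / (2 * k1)}"
  have "\<kappa> > 0" using gains_pos \<epsilon> by (simp add: \<kappa>_def)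
  have \<kappa>: "\<kappa> \<le> kq / 2" "\<kappa> \<le> \<alpha> * (2 - sqrt (2 * c) - \<epsilon>)" "\<kappa> \<le> kW / (2 * k1)"
    by (simp_all add: \<kappa>_def)
  define g where "g v = (norm (fst v))\<^sup>2 + (norm (fst (snd v)))\<^sup>2" for v :: err_state
  \<comment> \<open>The derivative of \<open>g\<close> along the flow. By
    \<open>inner_err_q_rhs\<close> it is free of \<open>w\<close>, so compactness of the region
    bounds it even if the reference velocity is unbounded.\<close>
  define h where "h = (\<lambda>(e, z, y). 2 * ((qvec e \<bullet> (z + eta kq \<alpha> (qone + e) e)) / 2
      - \<alpha> * ((norm (qone + e))\<^sup>2 - 1) * (qscal e + (norm e)\<^sup>2))
      + 2 * (z \<bullet> (- (k1 *\<^sub>R qvec e) - kW *\<^sub>R z + A *v y)))"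
  have "continuous_on (region c \<epsilon>) h"
    unfolding h_def split_beta by (intro continuous_intros) auto
  moreover have "compact (region c \<epsilon>)"
    using bounded_region closed_region by (simp add: compact_eq_bounded_closed)
  ultimately have "bounded (h ` region c \<epsilon>)"
    by (intro compact_imp_bounded compact_continuous_image)
  then obtain M where M: "\<And>v. v \<in> region c \<epsilon> \<Longrightarrow> \<bar>h v\<bar> \<le> M"
    by (auto simp: bounded_iff)
  have "((\<lambda>t. g (x t)) \<longlongrightarrow> 0) at_top"
  proof (rule lyapunov_rate_tendsto_0[where w = "\<lambda>t. lyap (x t)" and w' = "\<lambda>t. lyap_rate (x t)"
        and g' = "\<lambda>t. h (x t)" and \<kappa> = \<kappa> and M = M])
    fix t :: real assume t: "0 \<le> t"
    show "((\<lambda>t. lyap (x t)) has_vector_derivative lyap_rate (x t)) (at t within {0..})"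
      by (rule lyap_derivative[OF x[OF t]])
    note d1 = bounded_linear.has_vector_derivative[OF bounded_linear_fst x[OF t]]
    note d2 = bounded_linear.has_vector_derivative[OF bounded_linear_fst
        bounded_linear.has_vector_derivative[OF bounded_linear_snd x[OF t]]]
    have "h (x t) = 2 * (fst (x t) \<bullet> fst (err_field (w t) (x t))) + 2 * (fst (snd (x t)) \<bullet> fst (snd (err_field (w t) (x t))))"
      by (simp add: h_def err_field_def split_beta inner_err_q_rhs)
    then show "((\<lambda>t. g (x t)) has_vector_derivative h (x t)) (at t within {0..})"
      unfolding g_def
      using has_vector_derivative_add[OF has_vector_derivative_power2_norm[OF d1] has_vector_derivative_power2_norm[OF d2]]
      by simp
    show "0 \<le> lyap (x t)" using gains_pos by (simp add: lyap_def split_beta)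
    show "0 \<le> g (x t)" by (simp add: g_def)
    show "\<bar>h (x t)\<bar> \<le> M" by (rule M[OF inv[OF t]])
    obtain e z y where e: "x t = (e, z, y)" by (cases "x t")
    have "\<kappa> * (norm (qvec e))\<^sup>2 \<le> kq / 2 * (norm (qvec e))\<^sup>2"
      "\<kappa> * (norm z)\<^sup>2 \<le> kW / (2 * k1) * (norm z)\<^sup>2"
      by (rule mult_right_mono[OF \<kappa>(1)] mult_right_mono[OF \<kappa>(3)]; simp)+
    moreover have "\<kappa> * (qscal e)\<^sup>2 \<le> \<alpha> * (1 + qscal e + (norm (qone + e))\<^sup>2) * (qscal e)\<^sup>2"
    proof (rule mult_right_mono)
      have "2 - sqrt (2 * c) - \<epsilon> \<le> 1 + qscal e + (norm (qone + e))\<^sup>2"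
        using region_damping[OF inv[OF t]] by (simp add: e)
      then have "\<alpha> * (2 - sqrt (2 * c) - \<epsilon>) \<le> \<alpha> * (1 + qscal e + (norm (qone + e))\<^sup>2)"
        using gains_pos by simp
      with \<kappa>(2) show "\<kappa> \<le> \<alpha> * (1 + qscal e + (norm (qone + e))\<^sup>2)" by linarith
    qed simp
    moreover have "(norm e)\<^sup>2 = (qscal e)\<^sup>2 + (norm (qvec e))\<^sup>2"
      by (simp add: norm_quat_squared power2_norm_eq_inner)
    ultimately show "lyap_rate (x t) \<le> - \<kappa> * g (x t)"
      by (simp add: lyap_rate_def g_def e algebra_simps)
  qed (use \<open>\<kappa> > 0\<close> in auto)
  then have lim: "((\<lambda>t. sqrt (g (x t))) \<longlongrightarrow> 0) at_top"
    using tendsto_real_sqrt by fastforce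
  show "((\<lambda>t. fst (x t)) \<longlongrightarrow> 0) at_top" "((\<lambda>t. fst (snd (x t))) \<longlongrightarrow> 0) at_top"
    by (rule Lim_null_comparison[OF _ lim], rule always_eventually, simp add: g_def real_le_rsqrt)+
qed

end

section \<open>Transfer to the original closed loop\<close>

lemma qone_add_err_q: "qone + err_q a b = qcnj a \<otimes> b"
  by (simp add: err_q_def)

text \<open>The feedback cancels the gyroscopic term and the reference acceleration.
  \<open>Db\<close> is subtracted outside \<open>J\<close>, so the estimation error enters through
  the inverse inertia.\<close>

lemma err_W_rhs_feedback:
  assumes "inertia_matrix J"
  shows "err_W_rhs J D W0' W (feedback J k1 kq kW \<alpha> W0 W0' q W e eW Db) =
    - (k1 *\<^sub>R qvec e) - kW *\<^sub>R (eW - eta kq \<alpha> q e) + eta_dot kq \<alpha> W0 q e eW + matrix_inv J *v (D - Db)"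
proof -
  let ?u = "- (k1 *\<^sub>R qvec e) - kW *\<^sub>R (eW - eta kq \<alpha> q e) + eta_dot kq \<alpha> W0 q e eW + W0'"
  have "err_W_rhs J D W0' W (feedback J k1 kq kW \<alpha> W0 W0' q W e eW Db) =
      matrix_inv J *v (cross3 (J *v W) W + (- cross3 (J *v W) W + J *v ?u - Db) + D) - W0'"
    unfolding err_W_rhs_def feedback_def by (simp only: matrix_vector_right_distrib)
  also have "cross3 (J *v W) W + (- cross3 (J *v W) W + J *v ?u - Db) + D = J *v ?u + (D - Db)"
    by simp
  also have "matrix_inv J *v \<dots> = ?u + matrix_inv J *v (D - Db)"
    by (simp only: matrix_vector_right_distrib matrix_inv_inertia(1)[OF assms])
  finally show ?thesis by simp
qed

text \<open>The bound \<open>V \<le> c - \<delta>\<^sup>2 / (2 * kD)\<close> leaves exactly the room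
  needed for the initial estimation error \<open>\<Delta> - 0\<close>.\<close>

theorem theorem2:
  fixes J :: "real^3^3"
    and D Wi :: "real^3"
    and qi :: quat
    and q0 :: "real \<Rightarrow> quat"
    and W0 W0' :: "real \<Rightarrow> real^3"
    and \<delta> k1 kq kW kD \<alpha> c \<epsilon> :: real
  assumes "inertia_matrix J"
    and "reference_trajectory q0 W0 W0'"
    and "\<delta> > 0" and "norm D \<le> \<delta>"
    and "k1 > 0" and "kq > 0" and "kW > 0" and "\<alpha> > 0"
    and "0 < c" and "c < 2"
    and "0 \<le> \<epsilon>" and "\<epsilon> < min (2 - sqrt (2 * c)) 1"
    and "kD > \<delta>\<^sup>2 / (2 * c)"
    and "\<bar>(norm qi)\<^sup>2 - 1\<bar> \<le> \<epsilon>"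
    and "V k1 kq \<alpha> qi (err_q (q0 0) qi) (err_W (W0 0) Wi) \<le> c - \<delta>\<^sup>2 / (2 * kD)"
  shows "(\<exists>q W Db. closed_loop_solution J k1 kq kW kD \<alpha> D q0 W0 W0' q W Db
            \<and> q 0 = qi \<and> W 0 = Wi) \<and>
         (\<forall>q W Db. closed_loop_solution J k1 kq kW kD \<alpha> D q0 W0 W0' q W Db
            \<and> q 0 = qi \<and> W 0 = Wi
            \<longrightarrow> ((\<lambda>t. (err_q (q0 t) (q t), err_W (W0 t) (W t))) \<longlongrightarrow> (0, 0)) at_top)"
proof -
  note J = \<open>inertia_matrix J\<close>
  have "0 < \<delta>\<^sup>2 / (2 * c)" using \<open>\<delta> > 0\<close> \<open>0 < c\<close> by simp
  then have kD: "kD > 0" using \<open>kD > \<delta>\<^sup>2 / (2 * c)\<close> by linarith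
  interpret tracking_gains k1 kq kW kD \<alpha> "matrix_inv J"
    by unfold_locales (use assms kD matrix_inv_inertia(3)[OF J] in auto)
  have q0: "norm (q0 t) = 1" and dW0: "(W0 has_vector_derivative W0' t) (at t within {0..})"
    if "0 \<le> t" for t
    using assms(2) that by (auto simp: reference_trajectory_def)
  have W0: "continuous_on {0..} W0"
    unfolding continuous_on_eq_continuous_within
    using dW0 has_vector_derivative_continuous by blast
  have norm_err: "norm (qone + err_q (q0 t) q) = norm q" if "0 \<le> t" for t q
    using q0[OF that] by (simp add: qone_add_err_q norm_qmul norm_qcnj)
  have \<epsilon>: "\<epsilon> < 2 - sqrt (2 * c)" using assms by simp
  define ei where "ei = err_q (q0 0) qi"
  \<comment> \<open>The estimate starts at \<open>0\<close>, so the initial estimation error is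
    \<open>D\<close> itself.\<close>
  define u where "u = (ei, err_W (W0 0) Wi - eta kq \<alpha> (qone + ei) ei, D)"
  have n_ei: "norm (qone + ei) = norm qi" by (simp add: ei_def norm_err)
  have u: "u \<in> region c \<epsilon>"
  proof -
    have "(norm D)\<^sup>2 \<le> \<delta>\<^sup>2" using \<open>norm D \<le> \<delta>\<close> by (simp add: power_mono)
    then have "1 / (2 * kD) * (norm D)\<^sup>2 \<le> \<delta>\<^sup>2 / (2 * kD)"
      using kD by (simp add: divide_right_mono)
    moreover have "lyap u = V k1 kq \<alpha> qi ei (err_W (W0 0) Wi) + 1 / (2 * kD) * (norm D)\<^sup>2"
      by (simp add: lyap_def u_def V_def eta_cong[OF n_ei])
    ultimately have "lyap u \<le> c" using assms(15) by (simp add: ei_def)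
    then show ?thesis using assms(14) n_ei by (simp add: region_def u_def)
  qed
  show ?thesis
  proof (intro conjI allI impI)
    obtain x where x0: "x 0 = u"
      and x: "\<And>t. 0 \<le> t \<Longrightarrow> (x has_vector_derivative err_field (W0 t) (x t)) (at t within {0..})"
      using err_field_solution_exists[OF W0 u \<epsilon>] by blast
    define e where "e t = fst (x t)" for t
    define z where "z t = fst (snd (x t))" for t
    define y where "y t = snd (snd (x t))" for t
    \<comment> \<open>Inverse change of coordinates: multiplying by the conjugate of the unit
      quaternion \<open>q0 t\<close> gives back \<open>qone + e t\<close>.\<close>
    define q where "q t = q0 t \<otimes> (qone + e t)" for t
    define W where "W t = W0 t + (z t + eta kq \<alpha> (qone + e t) (e t))" for t
    define Db where "Db t = D - y t" for t
    note defs = e_def z_def y_def err_field_def split_beta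
    have nq: "norm (q t) = norm (qone + e t)" if "0 \<le> t" for t
      using q0[OF that] by (simp add: q_def norm_qmul)
    have eW: "err_W (W0 t) (W t) = z t + eta kq \<alpha> (qone + e t) (e t)" for t
      by (simp add: err_W_def W_def)
    have eq: "err_q (q0 t) (q t) = e t" if "0 \<le> t" for t
      using q0[OF that] by (simp add: err_q_def q_def qmul_cnj_left)
    have de: "(e has_vector_derivative
        err_q_rhs \<alpha> (W0 t) (qone + e t) (e t) (z t + eta kq \<alpha> (qone + e t) (e t))) (at t within {0..})"
      if "0 \<le> t" for t
      using bounded_linear.has_vector_derivative[OF bounded_linear_fst x[OF that]]
      by (simp add: defs[abs_def])
    note dx2 = bounded_linear.has_vector_derivative[OF bounded_linear_snd x]
    have dz: "(z has_vector_derivative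
        - (k1 *\<^sub>R qvec (e t)) - kW *\<^sub>R z t + matrix_inv J *v y t) (at t within {0..})"
      if "0 \<le> t" for t
      using bounded_linear.has_vector_derivative[OF bounded_linear_fst dx2[OF that]]
      by (simp add: defs[abs_def])
    have dy: "(y has_vector_derivative - ((kD / (2 * k1)) *\<^sub>R (matrix_inv J *v z t))) (at t within {0..})"
      if "0 \<le> t" for t
      using bounded_linear.has_vector_derivative[OF bounded_linear_snd dx2[OF that]]
      by (simp add: defs[abs_def])
    have "closed_loop_solution J k1 kq kW kD \<alpha> D q0 W0 W0' q W Db"
      unfolding closed_loop_solution_def Let_def
    proof (intro conjI allI impI)
      fix t :: real assume t: "0 \<le> t"
      show "((\<lambda>t. err_q (q0 t) (q t)) has_vector_derivative
          err_q_rhs \<alpha> (W0 t) (q t) (err_q (q0 t) (q t)) (err_W (W0 t) (W t))) (at t within {0..})"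
        using t by (intro has_vector_derivative_transform[OF _ _ de[OF t, folded eW err_q_rhs_cong[OF nq[OF t]] eq[OF t]]])
          (simp_all add: eq)
      have "((\<lambda>t. z t + eta kq \<alpha> (qone + e t) (e t)) has_vector_derivative
          (- (k1 *\<^sub>R qvec (e t)) - kW *\<^sub>R z t + matrix_inv J *v y t)
          + eta_dot kq \<alpha> (W0 t) (qone + e t) (e t) (z t + eta kq \<alpha> (qone + e t) (e t))) (at t within {0..})"
        by (intro has_vector_derivative_add dz[OF t] eta_derivative[OF de[OF t]])
      then show "((\<lambda>t. err_W (W0 t) (W t)) has_vector_derivative
          err_W_rhs J D (W0' t) (W t) (feedback J k1 kq kW \<alpha> (W0 t) (W0' t) (q t) (W t)
            (err_q (q0 t) (q t)) (err_W (W0 t) (W t)) (Db t))) (at t within {0..})"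
        unfolding err_W_rhs_feedback[OF J] eW eq[OF t] eta_cong[OF nq[OF t]] eta_dot_cong[OF nq[OF t]]
        by (simp add: Db_def add_ac)
      show "(Db has_vector_derivative (kD / (2 * k1)) *\<^sub>R
          (matrix_inv J *v (err_W (W0 t) (W t) - eta kq \<alpha> (q t) (err_q (q0 t) (q t))))) (at t within {0..})"
        unfolding eW eq[OF t] eta_cong[OF nq[OF t]] Db_def
        using has_vector_derivative_diff[OF has_vector_derivative_const dy[OF t]] by simp
    next
      show "Db 0 = 0" by (simp add: Db_def y_def x0 u_def)
    qed
    moreover have "q 0 = qi"
      using q0[of 0] by (simp add: q_def e_def x0 u_def ei_def qone_add_err_q qmul_cnj_right)
    moreover have "W 0 = Wi"
      by (simp add: W_def z_def e_def x0 u_def err_W_def)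
    ultimately show "\<exists>q W Db. closed_loop_solution J k1 kq kW kD \<alpha> D q0 W0 W0' q W Db
        \<and> q 0 = qi \<and> W 0 = Wi" by blast
  next
    \<comment> \<open>Every closed-loop solution, not only the one built above, becomes a solution
      of \<open>err_field\<close> in the coordinates \<open>x\<close>, so convergence needs no
      comparison of solutions.\<close>
    fix q W Db
    assume sol: "closed_loop_solution J k1 kq kW kD \<alpha> D q0 W0 W0' q W Db \<and> q 0 = qi \<and> W 0 = Wi"
    define e where "e t = err_q (q0 t) (q t)" for t
    define f where "f t = err_W (W0 t) (W t)" for t
    have nq: "norm (q t) = norm (qone + e t)" if "0 \<le> t" for t
      using norm_err[OF that] by (simp add: e_def)
    have de: "(e has_vector_derivative err_q_rhs \<alpha> (W0 t) (qone + e t) (e t) (f t)) (at t within {0..})"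
      and df: "(f has_vector_derivative - (k1 *\<^sub>R qvec (e t)) - kW *\<^sub>R (f t - eta kq \<alpha> (qone + e t) (e t))
        + eta_dot kq \<alpha> (W0 t) (qone + e t) (e t) (f t) + matrix_inv J *v (D - Db t)) (at t within {0..})"
      and dDb: "(Db has_vector_derivative (kD / (2 * k1)) *\<^sub>R
        (matrix_inv J *v (f t - eta kq \<alpha> (qone + e t) (e t)))) (at t within {0..})"
      if t: "0 \<le> t" for t
      using sol t
      unfolding closed_loop_solution_def Let_def err_W_rhs_feedback[OF J]
        err_q_rhs_cong[OF nq[OF t], symmetric] eta_cong[OF nq[OF t], symmetric]
        eta_dot_cong[OF nq[OF t], symmetric]
      unfolding e_def[symmetric] f_def[symmetric] by simp_all
    define x where "x t = (e t, f t - eta kq \<alpha> (qone + e t) (e t), D - Db t)" for t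
    have x: "(x has_vector_derivative err_field (W0 t) (x t)) (at t within {0..})" if "0 \<le> t" for t
    proof -
      have "((\<lambda>t. f t - eta kq \<alpha> (qone + e t) (e t)) has_vector_derivative
          - (k1 *\<^sub>R qvec (e t)) - kW *\<^sub>R (f t - eta kq \<alpha> (qone + e t) (e t)) + matrix_inv J *v (D - Db t))
          (at t within {0..})"
        using has_vector_derivative_diff[OF df[OF that] eta_derivative[OF de[OF that], where kq = kq]]
        by (simp add: algebra_simps)
      moreover have "((\<lambda>t. D - Db t) has_vector_derivative
          - ((kD / (2 * k1)) *\<^sub>R (matrix_inv J *v (f t - eta kq \<alpha> (qone + e t) (e t))))) (at t within {0..})"
        using has_vector_derivative_diff[OF has_vector_derivative_const dDb[OF that]] by simp
      ultimately show ?thesis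
        unfolding x_def err_field_def using de[OF that]
        by (auto intro!: has_vector_derivative_Pair)
    qed
    have "x 0 = u"
      using sol by (simp add: x_def u_def e_def f_def ei_def closed_loop_solution_def Let_def)
    with u have "x 0 \<in> region c \<epsilon>" by simp
    note lim = err_field_solution_tendsto_0[OF x this \<epsilon>]
    have e: "(e \<longlongrightarrow> 0) at_top" using lim(1) by (simp add: x_def)
    \<comment> \<open>\<open>eta\<close> is continuous and vanishes at zero error, so the limit of
      \<open>f - eta\<close> passes on to \<open>f\<close>.\<close>
    have "continuous_on UNIV (\<lambda>e. eta kq \<alpha> (qone + e) e)"
      by (intro continuous_intros)
    then have "isCont (\<lambda>e. eta kq \<alpha> (qone + e) e) 0"
      using continuous_on_eq_continuous_at[OF open_UNIV] by blast
    from isCont_tendsto_compose[OF this e]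
    have "((\<lambda>t. eta kq \<alpha> (qone + e t) (e t)) \<longlongrightarrow> 0) at_top" by (simp add: eta_def)
    from tendsto_add[OF lim(2) this] have "(f \<longlongrightarrow> 0) at_top" by (simp add: x_def)
    from tendsto_Pair[OF e this]
    show "((\<lambda>t. (err_q (q0 t) (q t), err_W (W0 t) (W t))) \<longlongrightarrow> (0, 0)) at_top"
      by (simp add: e_def f_def)
  qed
qed

end
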